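(* Let $k \ge 2$, $m \ge 2$, and let $F = F_m \circ F_{m-1} \circ \cdots \circ F_1 : \mathbb{C}^k \to \mathbb{C}^k$, where $F_i(z_1,\dots,z_k) = (z_2,z_3,\dots,z_k,\alpha_i z_1 + p_i(z_k))$ with $p_i$ a polynomial of degree $d_i \ge 2$ and $\alpha_i \ne 0$ for $1 \le i \le m$. Let $d = d_1 d_2 \cdots d_m$. Suppose $a \in \mathbb{C}^k$ is a $(k-1,1)$ saddle point of $F$, let $\lambda$ be the eigenvalue of $DF(a)$ with $|\lambda|>1$, and let $H = (h_1,\dots,h_k) : \mathbb{C} \to \mathbb{C}^k$ be an entire mapping parametrizing the unstable manifold of $a$, i.e. $H(\mathbb{C}) = W^u(a)$, $H(0) = a$ and $F \circ H(t) = H(\lambda t)$ for all $t \in \mathbb{C}$. Then for every $1 \le i \le k$ the coordinate $h_i$ is a transcendental entire function of mean type of order $\rho = \log d/\log|\lambda|$.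
   Context: A $(k-1,1)$ saddle of $F$ is a fixed point $a$ of $F$ such that the eigenvalues $\lambda_1,\dots,\lambda_k$ of $DF(a)$ satisfy $|\lambda_k| > 1$ and $|\lambda_i| < 1$ for $1 \le i \le k-1$; one writes $\lambda = \lambda_k$. $W^u(a) = \{z : F^{-n}(z) \to a \text{ as } n \to \infty\}$ is its unstable manifold; such a mapping $H$ always exists. The order of an entire function $g$ on $\mathbb{C}$ is $\rho = \limsup_{r \to \infty} \frac{\log\log \sup_{|z|=r}|g(z)|}{\log r}$; if $0<\rho<\infty$, its type is $\sigma = \limsup_{r\to\infty} r^{-\rho}\log \sup_{|z|=r}|g(z)|$, and $g$ is of mean type if $0<\sigma<\infty$. *)

theory Defs
  imports "HOL-Analysis.Analysis"
begin

(* The space C^k is complex ^ 'k with k = CARD('k).  A bijection e from {1..k} onto 'k numbers the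
   coordinates, so that z_i is z $ e i. *)

definition tuple :: "(nat \<Rightarrow> 'k::finite) \<Rightarrow> (nat \<Rightarrow> complex) \<Rightarrow> complex ^ 'k" where
  "tuple e f = (\<chi> j. f (inv_into {1..CARD('k)} e j))"

definition henon_step ::
    "(nat \<Rightarrow> 'k::finite) \<Rightarrow> complex \<Rightarrow> complex poly \<Rightarrow> complex ^ 'k \<Rightarrow> complex ^ 'k" where
  "henon_step e \<alpha> p z =
     tuple e (\<lambda>i. if i < CARD('k) then z $ e (i + 1)
                  else \<alpha> * z $ e 1 + poly p (z $ e CARD('k)))"

primrec henon_comp ::
    "(nat \<Rightarrow> 'k::finite) \<Rightarrow> (nat \<Rightarrow> complex) \<Rightarrow> (nat \<Rightarrow> complex poly) \<Rightarrow> nat \<Rightarrow>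
     complex ^ 'k \<Rightarrow> complex ^ 'k" where
  "henon_comp e \<alpha> p 0 = id"
| "henon_comp e \<alpha> p (Suc n) = henon_step e (\<alpha> (Suc n)) (p (Suc n)) \<circ> henon_comp e \<alpha> p n"

(* ev 1, ..., ev k are the eigenvalues of A listed with algebraic multiplicity;
   mat x is x times the identity matrix. *)
definition eigenvalue_list :: "complex ^ 'k ^ 'k \<Rightarrow> (nat \<Rightarrow> complex) \<Rightarrow> bool" where
  "eigenvalue_list A ev \<longleftrightarrow> (\<forall>x. det (mat x - A) = (\<Prod>i=1..CARD('k). x - ev i))"

(* Having a derivative of the form v |-> A v with A a complex matrix makes F complex differentiable at
   a, and determines A = DF(a). *)
definition saddle_point :: "(complex ^ 'k \<Rightarrow> complex ^ 'k) \<Rightarrow> complex ^ 'k \<Rightarrow> complex \<Rightarrow> bool" where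
  "saddle_point F a lam \<longleftrightarrow> F a = a \<and>
     (\<exists>A ev. (F has_derivative (\<lambda>v. A *v v)) (at a) \<and> eigenvalue_list A ev \<and>
        (\<forall>i\<in>{1..<CARD('k)}. cmod (ev i) < 1) \<and> cmod (ev CARD('k)) > 1 \<and> lam = ev CARD('k))"

(* Meaningful for bijective F, for which inv F is the inverse map. *)
definition unstable_manifold :: "('a::topological_space \<Rightarrow> 'a) \<Rightarrow> 'a \<Rightarrow> 'a set" where
  "unstable_manifold F a = {z. (\<lambda>n. (inv F ^^ n) z) \<longlonglongrightarrow> a}"

definition transcendental_entire :: "(complex \<Rightarrow> complex) \<Rightarrow> bool" where
  "transcendental_entire g \<longleftrightarrow> g holomorphic_on UNIV \<and> \<not> (\<exists>q. \<forall>z. g z = poly q z)"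

definition max_modulus :: "(complex \<Rightarrow> complex) \<Rightarrow> real \<Rightarrow> real" where
  "max_modulus g r = (SUP z\<in>sphere 0 r. cmod (g z))"

(* For nonconstant entire g the maximum modulus tends to infinity, so both logarithms are eventually
   taken of positive numbers; constants get order 0. *)
definition entire_order :: "(complex \<Rightarrow> complex) \<Rightarrow> ereal" where
  "entire_order g = Limsup at_top (\<lambda>r. ereal (ln (ln (max_modulus g r)) / ln r))"

(* Meaningful only if 0 < entire_order g < \<infinity>. *)
definition entire_type :: "(complex \<Rightarrow> complex) \<Rightarrow> ereal" where
  "entire_type g =
     Limsup at_top (\<lambda>r. ereal (r powr (- real_of_ereal (entire_order g)) * ln (max_modulus g r)))"

definition mean_type :: "(complex \<Rightarrow> complex) \<Rightarrow> bool" where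
  "mean_type g \<longleftrightarrow> 0 < entire_order g \<and> entire_order g < \<infinity> \<and>
     0 < entire_type g \<and> entire_type g < \<infinity>"

end

theory Submission
  imports Defs "HOL-Complex_Analysis.Complex_Analysis" "HOL-Real_Asymp.Real_Asymp"
begin

text \<open>
Put \<rho> = log d / log |\<lambda>|, so that |\<lambda>|^\<rho> = d. The theorem amounts to two estimates: every coordinate h of H
satisfies |h(t)| \<le> exp (K |t|^\<rho>) for |t| \<ge> 1, and along some sequence of points tending to infinity
|h(t)| \<ge> exp (c |t|^\<rho>) with c > 0. Lemma \<open>order_and_type_from_bounds\<close> reads off order, type and
transcendence from them.

The upper bound iterates the inequality 1 + |F z| \<le> C (1 + |z|)^d along H(\<lambda>t) = F(H(t)): each
multiplication of t by \<lambda> multiplies the logarithm of |H(t)| by at most d, up to a bounded error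
(\<open>curve_growth_from_functional_equation\<close>).

For the lower bound, one applies the factors F_1, ..., F_m cyclically to a point w and writes down its coordinates
followed by the new last coordinates that appear. This gives one scalar sequence with
Z(n+k) = \<alpha> Z(n) + p(Z(n+k-1)), the states of the orbit being its windows of length k. Suppose that
the initial window is smaller than a large constant R and that the sequence exceeds R at some time. The first
term that does so dominates all earlier ones, hence from there on the term p(Z(n+k-1)) wins, and the sequence grows
like an iterated power: after q full turns all coordinates have modulus at least exp (c d^q)
(\<open>henon_orbit_growth\<close>). A point of H(\<complex>) outside the polydisc of radius R exists by Liouville's theorem,
and dividing its parameter by a power of \<lambda> gives a starting point s with H(s) close to a, hence a small initial
window. As |\<lambda>^q s|^\<rho> is d^q |s|^\<rho>, this is the lower bound, for all coordinates at once.

Liouville's theorem requires that H is not constant, that is, that the unstable manifold is larger than {a}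
(\<open>unstable_manifold_nontrivial\<close>). Here the eigenvalues enter. Since \<lambda>^n is not an eigenvalue of A = DF(a) for
n \<ge> 2, the equation F(G(t)) = G(\<lambda>t) can be solved by entire curves G through a in the direction of an
eigenvector for \<lambda>, up to an error o(t^n) with n arbitrary
(\<open>approximate_unstable_curve_exists\<close>). For n so large that |\<lambda>|^n exceeds twice a local Lipschitz
constant L of F, the points G(t / \<lambda>^j) form a pseudo-orbit whose errors decay faster than forward iteration
expands, so it is shadowed by a true backward orbit that tends to a without being constant
(\<open>backward_orbit_shadowing\<close>).
\<close>

section \<open>Strict derivatives\<close>

text \<open>
Both points of the difference quotient vary. This uniformity gives a Lipschitz constant near \<open>a\<close> and controls
the effect of perturbing a curve that moves away from \<open>a\<close>, and it is inherited by compositions from the behaviour at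
a single point, so that no derivative of a composite map has to be computed elsewhere.
\<close>

definition has_strict_derivative ::
    "('a::real_normed_vector \<Rightarrow> 'b::real_normed_vector) \<Rightarrow> ('a \<Rightarrow> 'b) \<Rightarrow> 'a \<Rightarrow> bool" where
  "has_strict_derivative F F' a \<longleftrightarrow> bounded_linear F' \<and>
     (\<forall>\<epsilon>>0. \<exists>\<delta>>0. \<forall>x\<in>ball a \<delta>. \<forall>y\<in>ball a \<delta>. norm (F x - F y - F' (x - y)) \<le> \<epsilon> * norm (x - y))"

lemma has_strict_derivativeE:
  assumes "has_strict_derivative F F' a" "\<epsilon> > 0"
  obtains \<delta> where "\<delta> > 0"
    "\<And>x y. x \<in> ball a \<delta> \<Longrightarrow> y \<in> ball a \<delta> \<Longrightarrow> norm (F x - F y - F' (x - y)) \<le> \<epsilon> * norm (x - y)"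
  using assms unfolding has_strict_derivative_def by metis

lemma has_strict_derivative_imp_has_derivative:
  assumes "has_strict_derivative F F' a"
  shows "(F has_derivative F') (at a)"
  unfolding has_derivative_at_alt
proof (intro conjI allI impI)
  show "bounded_linear F'" using assms by (simp add: has_strict_derivative_def)
  fix \<epsilon> :: real assume "0 < \<epsilon>"
  then obtain \<delta> where \<delta>: "\<delta> > 0" "\<And>x y. x \<in> ball a \<delta> \<Longrightarrow> y \<in> ball a \<delta> \<Longrightarrow>
      norm (F x - F y - F' (x - y)) \<le> \<epsilon> * norm (x - y)"
    using has_strict_derivativeE[OF assms] by metis
  show "\<exists>d>0. \<forall>y. norm (y - a) < d \<longrightarrow> norm (F y - F a - F' (y - a)) \<le> \<epsilon> * norm (y - a)"
    using \<delta> by (intro exI[of _ \<delta>]) (auto simp: dist_norm norm_minus_commute)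
qed

lemma has_strict_derivative_imp_Lipschitz:
  assumes "has_strict_derivative F F' a"
  obtains L \<delta> where "L > 0" "\<delta> > 0"
    "\<And>x y. x \<in> ball a \<delta> \<Longrightarrow> y \<in> ball a \<delta> \<Longrightarrow> norm (F x - F y) \<le> L * norm (x - y)"
proof -
  obtain K where K: "K > 0" "\<And>v. norm (F' v) \<le> norm v * K"
    using assms bounded_linear.pos_bounded unfolding has_strict_derivative_def by metis
  obtain \<delta> where \<delta>: "\<delta> > 0" "\<And>x y. x \<in> ball a \<delta> \<Longrightarrow> y \<in> ball a \<delta> \<Longrightarrow>
      norm (F x - F y - F' (x - y)) \<le> 1 * norm (x - y)"
    using has_strict_derivativeE[OF assms zero_less_one] by metis
  show thesis
  proof (rule that[of "1 + K" \<delta>])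
    fix x y assume "x \<in> ball a \<delta>" "y \<in> ball a \<delta>"
    have "norm (F x - F y) \<le> norm (F x - F y - F' (x - y)) + norm (F' (x - y))"
      by (metis diff_add_cancel norm_triangle_ineq)
    also have "\<dots> \<le> 1 * norm (x - y) + norm (x - y) * K" using \<delta>(2) K(2) \<open>x \<in> _\<close> \<open>y \<in> _\<close> by (intro add_mono)
    finally show "norm (F x - F y) \<le> (1 + K) * norm (x - y)" by (simp add: algebra_simps)
  qed (use K \<delta> in auto)
qed

lemma has_strict_derivative_linear:
  assumes "bounded_linear F" shows "has_strict_derivative F F a"
proof -
  have "F x - F y - F (x - y) = 0" for x y using assms by (simp add: linear_simps)
  thus ?thesis unfolding has_strict_derivative_def using assms
    by (auto intro!: exI[of _ "1::real"])
qed

lemma has_strict_derivative_add: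
  assumes "has_strict_derivative F F' a" "has_strict_derivative G G' a"
  shows "has_strict_derivative (\<lambda>x. F x + G x) (\<lambda>v. F' v + G' v) a"
  unfolding has_strict_derivative_def
proof (intro conjI allI impI)
  show "bounded_linear (\<lambda>v. F' v + G' v)"
    using assms bounded_linear_add unfolding has_strict_derivative_def by blast
  fix \<epsilon> :: real assume "\<epsilon> > 0"
  hence "\<epsilon>/2 > 0" by simp
  obtain \<delta>1 where \<delta>1: "\<delta>1 > 0" "\<And>x y. x \<in> ball a \<delta>1 \<Longrightarrow> y \<in> ball a \<delta>1 \<Longrightarrow>
      norm (F x - F y - F' (x - y)) \<le> \<epsilon>/2 * norm (x - y)"
    using has_strict_derivativeE[OF assms(1) \<open>\<epsilon>/2 > 0\<close>] by metis
  obtain \<delta>2 where \<delta>2: "\<delta>2 > 0" "\<And>x y. x \<in> ball a \<delta>2 \<Longrightarrow> y \<in> ball a \<delta>2 \<Longrightarrow>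
      norm (G x - G y - G' (x - y)) \<le> \<epsilon>/2 * norm (x - y)"
    using has_strict_derivativeE[OF assms(2) \<open>\<epsilon>/2 > 0\<close>] by metis
  show "\<exists>\<delta>>0. \<forall>x\<in>ball a \<delta>. \<forall>y\<in>ball a \<delta>.
         norm (F x + G x - (F y + G y) - (F' (x - y) + G' (x - y))) \<le> \<epsilon> * norm (x - y)"
  proof (intro exI[of _ "min \<delta>1 \<delta>2"] conjI ballI)
    fix x y assume xy: "x \<in> ball a (min \<delta>1 \<delta>2)" "y \<in> ball a (min \<delta>1 \<delta>2)"
    have "norm (F x + G x - (F y + G y) - (F' (x - y) + G' (x - y))) =
        norm ((F x - F y - F' (x - y)) + (G x - G y - G' (x - y)))" by (simp add: algebra_simps)
    also have "\<dots> \<le> norm (F x - F y - F' (x - y)) + norm (G x - G y - G' (x - y))"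
      by (rule norm_triangle_ineq)
    also have "\<dots> \<le> \<epsilon>/2 * norm (x - y) + \<epsilon>/2 * norm (x - y)"
      using xy by (intro add_mono \<delta>1 \<delta>2) auto
    finally show "norm (F x + G x - (F y + G y) - (F' (x - y) + G' (x - y))) \<le> \<epsilon> * norm (x - y)"
      by simp
  qed (use \<delta>1 \<delta>2 in auto)
qed

lemma has_strict_derivative_compose:
  assumes F: "has_strict_derivative F F' a" and G: "has_strict_derivative G G' (F a)"
  shows "has_strict_derivative (\<lambda>x. G (F x)) (\<lambda>v. G' (F' v)) a"
  unfolding has_strict_derivative_def
proof (intro conjI allI impI)
  show "bounded_linear (\<lambda>v. G' (F' v))"
    using assms bounded_linear_compose unfolding has_strict_derivative_def by blast
  have lin: "bounded_linear G'" using G by (simp add: has_strict_derivative_def)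
  fix \<epsilon> :: real assume "\<epsilon> > 0"
  obtain L \<delta>1 where L: "L > 0" "\<delta>1 > 0"
    "\<And>x y. x \<in> ball a \<delta>1 \<Longrightarrow> y \<in> ball a \<delta>1 \<Longrightarrow> norm (F x - F y) \<le> L * norm (x - y)"
    using has_strict_derivative_imp_Lipschitz[OF F] by metis
  obtain K where K: "K > 0" "\<And>v. norm (G' v) \<le> norm v * K"
    using lin bounded_linear.pos_bounded by metis
  have pos: "\<epsilon>/(2*L) > 0" "\<epsilon>/(2*K) > 0" using L K \<open>\<epsilon> > 0\<close> by auto
  obtain \<delta>2 where \<delta>2: "\<delta>2 > 0" "\<And>x y. x \<in> ball (F a) \<delta>2 \<Longrightarrow> y \<in> ball (F a) \<delta>2 \<Longrightarrow>
      norm (G x - G y - G' (x - y)) \<le> \<epsilon>/(2*L) * norm (x - y)"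
    using has_strict_derivativeE[OF G pos(1)] by metis
  obtain \<delta>3 where \<delta>3: "\<delta>3 > 0" "\<And>x y. x \<in> ball a \<delta>3 \<Longrightarrow> y \<in> ball a \<delta>3 \<Longrightarrow>
      norm (F x - F y - F' (x - y)) \<le> \<epsilon>/(2*K) * norm (x - y)"
    using has_strict_derivativeE[OF F pos(2)] by metis
  define \<delta> where "\<delta> = Min {\<delta>1, \<delta>3, \<delta>2 / L}"
  have \<delta>: "\<delta> > 0" "\<delta> \<le> \<delta>1" "\<delta> \<le> \<delta>3" "\<delta> \<le> \<delta>2 / L" using L \<delta>2 \<delta>3 by (auto simp: \<delta>_def)
  have in_ball: "F x \<in> ball (F a) \<delta>2" if "x \<in> ball a \<delta>" for x
  proof -
    have "norm (F a - F x) \<le> L * norm (a - x)" using that \<delta> by (intro L) auto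
    also have "\<dots> < L * (\<delta>2 / L)" using that \<delta> L by (intro mult_strict_left_mono) (auto simp: dist_norm)
    finally show ?thesis using L by (simp add: dist_norm)
  qed
  show "\<exists>\<delta>>0. \<forall>x\<in>ball a \<delta>. \<forall>y\<in>ball a \<delta>.
         norm (G (F x) - G (F y) - G' (F' (x - y))) \<le> \<epsilon> * norm (x - y)"
  proof (intro exI[of _ \<delta>] conjI ballI)
    fix x y assume xy: "x \<in> ball a \<delta>" "y \<in> ball a \<delta>"
    have "G (F x) - G (F y) - G' (F' (x - y)) = (G (F x) - G (F y) - G' (F x - F y)) +
        G' (F x - F y - F' (x - y))"
      using lin by (simp add: linear_simps)
    hence "norm (G (F x) - G (F y) - G' (F' (x - y))) \<le> norm (G (F x) - G (F y) - G' (F x - F y)) +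
        norm (G' (F x - F y - F' (x - y)))" by (metis norm_triangle_ineq)
    also have "\<dots> \<le> \<epsilon>/(2*L) * norm (F x - F y) + norm (F x - F y - F' (x - y)) * K"
      by (intro add_mono \<delta>2 in_ball xy K)
    also have "\<dots> \<le> \<epsilon>/(2*L) * (L * norm (x - y)) + (\<epsilon>/(2*K) * norm (x - y)) * K"
      using xy \<delta> pos K by (intro add_mono mult_left_mono mult_right_mono L \<delta>3) auto
    also have "\<dots> = \<epsilon> * norm (x - y)" using L K by (simp add: field_simps)
    finally show "norm (G (F x) - G (F y) - G' (F' (x - y))) \<le> \<epsilon> * norm (x - y)" .
  qed (use \<delta> in auto)
qed

lemma has_strict_derivative_poly:
  fixes q :: "complex poly"
  shows "has_strict_derivative (poly q) (\<lambda>v. poly (pderiv q) a * v) a"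
  unfolding has_strict_derivative_def
proof (intro conjI allI impI)
  show "bounded_linear (\<lambda>v. poly (pderiv q) a * v)" by (rule bounded_linear_mult_right)
  fix \<epsilon> :: real assume "\<epsilon> > 0"
  have "isCont (poly (pderiv q)) a" by simp
  then obtain \<delta> where \<delta>: "\<delta> > 0" "\<And>x. dist x a < \<delta> \<Longrightarrow> dist (poly (pderiv q) x) (poly (pderiv q) a) < \<epsilon>"
    using \<open>\<epsilon> > 0\<close> unfolding continuous_at_eps_delta by blast
  show "\<exists>\<delta>>0. \<forall>x\<in>ball a \<delta>. \<forall>y\<in>ball a \<delta>.
      norm (poly q x - poly q y - poly (pderiv q) a * (x - y)) \<le> \<epsilon> * norm (x - y)"
  proof (intro exI[of _ \<delta>] conjI ballI)
    fix x y assume xy: "x \<in> ball a \<delta>" "y \<in> ball a \<delta>"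
    have "norm ((poly q x - poly (pderiv q) a * x) - (poly q y - poly (pderiv q) a * y)) \<le> \<epsilon> * norm (x - y)"
    proof (rule field_differentiable_bound[of "ball a \<delta>" _ "\<lambda>z. poly (pderiv q) z - poly (pderiv q) a"])
      fix z assume "z \<in> ball a \<delta>"
      show "((\<lambda>w. poly q w - poly (pderiv q) a * w) has_field_derivative
          poly (pderiv q) z - poly (pderiv q) a) (at z within ball a \<delta>)"
        by (auto intro!: derivative_eq_intros)
      show "norm (poly (pderiv q) z - poly (pderiv q) a) \<le> \<epsilon>"
        using \<delta>(2)[of z] \<open>z \<in> _\<close> by (simp add: dist_norm norm_minus_commute)
    qed (use xy in auto)
    thus "norm (poly q x - poly q y - poly (pderiv q) a * (x - y)) \<le> \<epsilon> * norm (x - y)"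
      by (simp add: algebra_simps)
  qed (use \<delta> in auto)
qed

lemma has_strict_derivative_vec:
  fixes F :: "'a::real_normed_vector \<Rightarrow> complex ^ 'n"
  assumes "\<And>j. has_strict_derivative (\<lambda>x. F x $ j) (F' j) a"
  shows "has_strict_derivative F (\<lambda>v. \<chi> j. F' j v) a"
  unfolding has_strict_derivative_def
proof (intro conjI allI impI)
  have bl: "bounded_linear (F' j)" for j using assms by (simp add: has_strict_derivative_def)
  show "bounded_linear (\<lambda>v. \<chi> j. F' j v)"
  proof -
    have "\<exists>K. \<forall>v. norm (F' j v) \<le> norm v * K" for j using bounded_linear.bounded[OF bl] .
    then obtain K where K: "\<And>j v. norm (F' j v) \<le> norm v * K j" by metis
    show ?thesis
    proof (rule bounded_linear_intro[where K = "\<Sum>j\<in>UNIV. K j"])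
      fix v
      have "norm (\<chi> j. F' j v) \<le> (\<Sum>j\<in>UNIV. norm (F' j v))"
        unfolding norm_vec_def by (rule order_trans[OF L2_set_le_sum]) auto
      also have "\<dots> \<le> (\<Sum>j\<in>UNIV. norm v * K j)" by (intro sum_mono K)
      finally show "norm (\<chi> j. F' j v) \<le> norm v * (\<Sum>j\<in>UNIV. K j)" by (simp add: sum_distrib_left)
    qed (use bl in \<open>auto simp: vec_eq_iff linear_simps\<close>)
  qed
  fix \<epsilon> :: real assume "\<epsilon> > 0"
  hence pos: "\<epsilon> / CARD('n) > 0" by simp
  have "\<exists>\<delta>>0. \<forall>x\<in>ball a \<delta>. \<forall>y\<in>ball a \<delta>. norm (F x $ j - F y $ j - F' j (x - y)) \<le> \<epsilon> / CARD('n) * norm (x - y)" for j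
    using assms[of j] pos unfolding has_strict_derivative_def by blast
  then obtain \<delta> where \<delta>: "\<And>j. \<delta> j > 0" "\<And>j x y. x \<in> ball a (\<delta> j) \<Longrightarrow> y \<in> ball a (\<delta> j) \<Longrightarrow>
      norm (F x $ j - F y $ j - F' j (x - y)) \<le> \<epsilon> / CARD('n) * norm (x - y)" by metis
  show "\<exists>\<delta>>0. \<forall>x\<in>ball a \<delta>. \<forall>y\<in>ball a \<delta>. norm (F x - F y - (\<chi> j. F' j (x - y))) \<le> \<epsilon> * norm (x - y)"
  proof (intro exI[of _ "Min (range \<delta>)"] conjI ballI)
    show "Min (range \<delta>) > 0" using \<delta>(1) by (subst Min_gr_iff) auto
    have le: "Min (range \<delta>) \<le> \<delta> j" for j by (intro Min_le) auto
    fix x y assume xy: "x \<in> ball a (Min (range \<delta>))" "y \<in> ball a (Min (range \<delta>))"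
    have "norm (F x - F y - (\<chi> j. F' j (x - y))) \<le> (\<Sum>j\<in>UNIV. norm ((F x - F y - (\<chi> j. F' j (x - y))) $ j))"
      unfolding norm_vec_def by (rule L2_set_le_sum) auto
    also have "\<dots> \<le> (\<Sum>j\<in>(UNIV :: 'n set). \<epsilon> / CARD('n) * norm (x - y))"
    proof (rule sum_mono)
      fix j
      have "x \<in> ball a (\<delta> j)" "y \<in> ball a (\<delta> j)" using xy le[of j] by auto
      thus "norm ((F x - F y - (\<chi> j. F' j (x - y))) $ j) \<le> \<epsilon> / CARD('n) * norm (x - y)"
        using \<delta>(2)[of x j y] by simp
    qed
    also have "\<dots> = \<epsilon> * norm (x - y)" by simp
    finally show "norm (F x - F y - (\<chi> j. F' j (x - y))) \<le> \<epsilon> * norm (x - y)" .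
  qed
qed

section \<open>Approximate unstable curves\<close>

lemma norm_vector_scalar_mult: "norm (c *s v) = cmod c * norm v" for v :: "complex ^ 'n"
  unfolding norm_vec_def L2_set_def
  by (simp add: norm_mult power_mult_distrib sum_distrib_left[symmetric] real_sqrt_mult)

lemma mat_vector_mult: "mat c *v v = c *s v" for v :: "complex ^ 'n"
  by (simp add: vec_eq_iff matrix_vector_mult_def mat_def if_distrib[of "\<lambda>x. x * _"] cong: if_cong)

lemma eigenvector_from_det:
  fixes A :: "complex ^ 'n ^ 'n"
  assumes "det (mat c - A) = 0"
  obtains v where "v \<noteq> 0" "A *v v = c *s v"
proof -
  have "\<not> invertible (mat c - A)" using assms invertible_det_nz by blast
  then obtain v where v: "(mat c - A) *v v = 0" "v \<noteq> 0"
    using invertible_left_inverse matrix_left_invertible_ker by blast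
  thus thesis by (intro that[of v]) (simp_all add: matrix_vector_mult_diff_rdistrib mat_vector_mult)
qed

lemma solve_from_det:
  fixes A :: "complex ^ 'n ^ 'n"
  assumes "det (mat c - A) \<noteq> 0"
  obtains v where "c *s v - A *v v = w"
proof -
  have "invertible (mat c - A)" using assms invertible_det_nz by blast
  then obtain B where "(mat c - A) ** B = mat 1" unfolding invertible_def by blast
  hence "(mat c - A) *v (B *v w) = w" by (simp add: matrix_vector_mul_assoc)
  thus thesis by (intro that[of "B *v w"]) (simp add: matrix_vector_mult_diff_rdistrib mat_vector_mult)
qed

text \<open>
A holomorphic function that is o(t^n) vanishes at 0 to order n + 1. Splitting off one factor t lowers n, and for
n = 0 the limit is the derivative.
\<close>

lemma holomorphic_next_coefficient:
  fixes f :: "complex \<Rightarrow> complex"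
  assumes "f holomorphic_on UNIV" "((\<lambda>t. f t / t ^ n) \<longlongrightarrow> 0) (at 0)"
  obtains R where "((\<lambda>t. f t / t ^ Suc n) \<longlongrightarrow> R) (at 0)"
  using assms
proof (induction n arbitrary: f thesis)
  case 0
  have "isCont f 0" using 0(2) holomorphic_on_imp_continuous_on continuous_on_eq_continuous_at by blast
  hence "f 0 = 0" using 0(3) unfolding isCont_def by (intro LIM_unique[of f _ 0]) auto
  moreover have "(f has_field_derivative deriv f 0) (at 0)"
    using 0(2) holomorphic_derivI by blast
  ultimately show ?case using 0(1) by (auto simp: has_field_derivative_iff)
next
  case (Suc n)
  have "((\<lambda>t. (f t / t ^ Suc n) * t ^ Suc n) \<longlongrightarrow> 0 * 0 ^ Suc n) (at 0)"
    by (intro tendsto_mult Suc.prems tendsto_intros)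
  moreover have "\<forall>\<^sub>F t in at 0. (f t / t ^ Suc n) * t ^ Suc n = f t"
    by (auto simp: eventually_at_filter)
  ultimately have "(f \<longlongrightarrow> 0) (at 0)" by (simp add: tendsto_cong)
  moreover have "isCont f 0" using Suc.prems(2) holomorphic_on_imp_continuous_on continuous_on_eq_continuous_at by blast
  ultimately have f0: "f 0 = 0" unfolding isCont_def using LIM_unique by blast
  define g where "g t = (if t = 0 then deriv f 0 else (f t - f 0) / (t - 0))" for t
  have "g holomorphic_on UNIV" unfolding g_def using Suc.prems(2) by (intro pole_lemma) auto
  moreover have eq: "f t / t ^ Suc k = g t / t ^ k" if "t \<noteq> 0" for t k using that f0 by (simp add: g_def)
  have tr: "((\<lambda>t. f t / t ^ Suc k) \<longlongrightarrow> l) (at 0) \<longleftrightarrow> ((\<lambda>t. g t / t ^ k) \<longlongrightarrow> l) (at 0)" for k l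
    by (intro tendsto_cong) (use eq in \<open>auto simp: eventually_at_filter simp del: power_Suc\<close>)
  ultimately show ?case using Suc.IH[of g] Suc.prems(1,3) tr by metis
qed

definition entire_curve :: "(complex \<Rightarrow> complex ^ 'n) \<Rightarrow> bool" where
  "entire_curve G \<longleftrightarrow> (\<forall>j. (\<lambda>t. G t $ j) holomorphic_on UNIV)"

lemma entire_curve_tendsto:
  assumes "entire_curve G" shows "(G \<longlongrightarrow> G z) (at z)"
proof (rule vec_tendstoI)
  fix j
  have "isCont (\<lambda>t. G t $ j) z"
    using assms holomorphic_on_imp_continuous_on continuous_on_eq_continuous_at
    unfolding entire_curve_def by blast
  thus "((\<lambda>t. G t $ j) \<longlongrightarrow> G z $ j) (at z)" by (simp add: isCont_def)
qed

lemma entire_curve_next_coefficient: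
  fixes G :: "complex \<Rightarrow> complex ^ 'n"
  assumes "entire_curve G" "((\<lambda>t. inverse (t ^ n) *s G t) \<longlongrightarrow> 0) (at 0)"
  obtains R where "((\<lambda>t. inverse (t ^ Suc n) *s G t) \<longlongrightarrow> R) (at 0)"
proof -
  have "\<exists>R. ((\<lambda>t. G t $ j / t ^ Suc n) \<longlongrightarrow> R) (at 0)" for j
  proof -
    have "((\<lambda>t. (inverse (t ^ n) *s G t) $ j) \<longlongrightarrow> 0 $ j) (at 0)" by (intro tendsto_vec_nth assms)
    hence "((\<lambda>t. G t $ j / t ^ n) \<longlongrightarrow> 0) (at 0)" by (simp add: field_simps)
    thus ?thesis using holomorphic_next_coefficient assms(1) unfolding entire_curve_def by metis
  qed
  then obtain R where "\<And>j. ((\<lambda>t. G t $ j / t ^ Suc n) \<longlongrightarrow> R j) (at 0)" by metis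
  hence "((\<lambda>t. inverse (t ^ Suc n) *s G t) \<longlongrightarrow> (\<chi> j. R j)) (at 0)"
    by (intro vec_tendstoI) (simp add: field_simps)
  thus thesis by (rule that)
qed

text \<open>
Adding c t^n to a curve through \<open>a\<close> changes its image to leading order by F'(c) t^n only, although the two points
compared are both different from \<open>a\<close>; this is where strictness of the derivative is used.
\<close>

lemma strict_remainder_tendsto_0:
  fixes F :: "complex ^ 'n \<Rightarrow> complex ^ 'n"
  assumes F: "has_strict_derivative F F' a" and G: "(G \<longlongrightarrow> a) (at 0)" and n: "n \<ge> 1"
  shows "((\<lambda>t. inverse (t ^ n) *s (F (G t + t ^ n *s c) - F (G t) - F' (t ^ n *s c))) \<longlongrightarrow> 0) (at 0)"
proof (rule tendstoI)
  fix \<epsilon> :: real assume "\<epsilon> > 0"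
  hence "\<epsilon> / (norm c + 1) > 0" by (simp add: add_nonneg_pos)
  then obtain \<delta> where \<delta>: "\<delta> > 0" "\<And>x y. x \<in> ball a \<delta> \<Longrightarrow> y \<in> ball a \<delta> \<Longrightarrow>
     norm (F x - F y - F' (x - y)) \<le> \<epsilon> / (norm c + 1) * norm (x - y)"
    using has_strict_derivativeE[OF F] by metis
  have "((\<lambda>t. t ^ n *s c) \<longlongrightarrow> 0) (at 0)"
  proof (rule vec_tendstoI)
    fix j
    have "((\<lambda>t. t ^ n * c $ j) \<longlongrightarrow> 0 ^ n * c $ j) (at 0)" by (intro tendsto_intros)
    thus "((\<lambda>t. (t ^ n *s c) $ j) \<longlongrightarrow> 0 $ j) (at 0)" using n by (simp add: power_0_left)
  qed
  from tendsto_add[OF G this] have G': "((\<lambda>t. G t + t ^ n *s c) \<longlongrightarrow> a) (at 0)" by simp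
  have "eventually (\<lambda>t. t \<noteq> 0) (at (0::complex))" by (simp add: eventually_at_filter)
  with tendstoD[OF G \<delta>(1)] tendstoD[OF G' \<delta>(1)]
  show "\<forall>\<^sub>F t in at 0. dist (inverse (t ^ n) *s (F (G t + t ^ n *s c) - F (G t) - F' (t ^ n *s c))) 0 < \<epsilon>"
  proof eventually_elim
    case (elim t)
    have "norm (F (G t + t ^ n *s c) - F (G t) - F' (G t + t ^ n *s c - G t)) \<le>
        \<epsilon> / (norm c + 1) * norm (G t + t ^ n *s c - G t)"
      using elim by (intro \<delta>) (auto simp: dist_commute)
    hence le: "norm (F (G t + t ^ n *s c) - F (G t) - F' (t ^ n *s c)) \<le> \<epsilon> / (norm c + 1) * (cmod t ^ n * norm c)"
      by (simp add: norm_vector_scalar_mult norm_power)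
    have "norm (inverse (t ^ n) *s (F (G t + t ^ n *s c) - F (G t) - F' (t ^ n *s c))) =
        inverse (cmod t ^ n) * norm (F (G t + t ^ n *s c) - F (G t) - F' (t ^ n *s c))"
      unfolding norm_vector_scalar_mult by (simp add: norm_power norm_inverse)
    also have "\<dots> \<le> inverse (cmod t ^ n) * (\<epsilon> / (norm c + 1) * (cmod t ^ n * norm c))"
      by (intro mult_left_mono le) auto
    also have "\<dots> = \<epsilon> * (norm c / (norm c + 1))" using elim by (simp add: field_simps)
    also have "\<dots> < \<epsilon> * 1" using \<open>\<epsilon> > 0\<close>
      by (intro mult_strict_left_mono) (auto simp: divide_less_eq add_nonneg_pos)
    finally show ?case by simp
  qed
qed

text \<open>
The functional equation of the unstable manifold is required only up to an error of finite order, which an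
induction on n can reach with no convergence question; shadowing makes up for the error.
\<close>

definition approximate_unstable_curve where
  "approximate_unstable_curve F a lam v n G \<longleftrightarrow> entire_curve G \<and> G 0 = a \<and>
     ((\<lambda>t. inverse t *s (G t - a)) \<longlongrightarrow> v) (at 0) \<and>
     ((\<lambda>t. inverse (t ^ n) *s (F (G t) - G (lam * t))) \<longlongrightarrow> 0) (at 0)"

text \<open>
If the error of G is R t^(n+1) to leading order, then adding c t^(n+1) to G changes the error by
(A c - \<lambda>^(n+1) c) t^(n+1), again to leading order. As \<lambda>^(n+1) is not an eigenvalue of A, some c cancels R. The
induction starts with the tangent line.
\<close>

lemma approximate_unstable_curve_exists:
  fixes F :: "complex ^ 'n \<Rightarrow> complex ^ 'n"
  assumes F: "has_strict_derivative F (\<lambda>v. A *v v) a" "F a = a"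
    and entire: "\<And>G. entire_curve G \<Longrightarrow> entire_curve (\<lambda>t. F (G t))"
    and v: "A *v v = lam *s v"
    and det: "\<And>n. n \<ge> 2 \<Longrightarrow> det (mat (lam ^ n) - A) \<noteq> 0"
    and "n \<ge> 1"
  shows "\<exists>G. approximate_unstable_curve F a lam v n G"
  using \<open>n \<ge> 1\<close>
proof (induction n rule: nat_induct_at_least)
  case base
  have "approximate_unstable_curve F a lam v 1 (\<lambda>t. a + t *s v)"
    unfolding approximate_unstable_curve_def
  proof (intro conjI)
    show "entire_curve (\<lambda>t. a + t *s v)"
      unfolding entire_curve_def by (auto intro!: holomorphic_intros)
    show "a + 0 *s v = a" by simp
    have "\<forall>\<^sub>F t in at 0. inverse t *s (a + t *s v - a) = v"
      by (auto simp: eventually_at_filter vector_smult_assoc)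
    thus "((\<lambda>t. inverse t *s (a + t *s v - a)) \<longlongrightarrow> v) (at 0)" by (rule tendsto_eventually)
    have eq: "F (a + t *s v) - (a + (lam * t) *s v) = F (a + t ^ 1 *s v) - F a - A *v (t ^ 1 *s v)" for t
      using F(2) v by (simp add: vector_scalar_commute vector_smult_assoc mult.commute)
    have "((\<lambda>t. inverse (t ^ 1) *s (F (a + t ^ 1 *s v) - F a - A *v (t ^ 1 *s v))) \<longlongrightarrow> 0) (at 0)"
      using F(1) by (rule strict_remainder_tendsto_0) auto
    thus "((\<lambda>t. inverse (t ^ 1) *s (F (a + t *s v) - (a + (lam * t) *s v))) \<longlongrightarrow> 0) (at 0)"
      by (simp only: eq)
  qed
  thus ?case by blast
next
  case (Suc n)
  then obtain G where G: "entire_curve G" "G 0 = a" "((\<lambda>t. inverse t *s (G t - a)) \<longlongrightarrow> v) (at 0)"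
     "((\<lambda>t. inverse (t ^ n) *s (F (G t) - G (lam * t))) \<longlongrightarrow> 0) (at 0)"
    unfolding approximate_unstable_curve_def by blast
  have "entire_curve (\<lambda>t. F (G t) - G (lam * t))"
  proof -
    have "((\<lambda>t. G t $ j) \<circ> (\<lambda>t. lam * t)) holomorphic_on UNIV" for j
      using G(1) by (intro holomorphic_on_compose_gen[where t = UNIV]) (auto simp: entire_curve_def intro!: holomorphic_intros)
    thus ?thesis using entire[OF G(1)] unfolding entire_curve_def by (auto intro!: holomorphic_intros simp: o_def)
  qed
  then obtain R where R: "((\<lambda>t. inverse (t ^ Suc n) *s (F (G t) - G (lam * t))) \<longlongrightarrow> R) (at 0)"
    using entire_curve_next_coefficient G(4) by blast
  obtain c where c: "lam ^ Suc n *s c - A *v c = R"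
    using solve_from_det[OF det[of "Suc n"]] Suc.hyps by auto
  let ?G = "\<lambda>t. G t + t ^ Suc n *s c"
  have "approximate_unstable_curve F a lam v (Suc n) ?G"
    unfolding approximate_unstable_curve_def
  proof (intro conjI)
    show "entire_curve ?G"
      using G(1) unfolding entire_curve_def by (auto intro!: holomorphic_intros)
    show "G 0 + 0 ^ Suc n *s c = a" using G by simp
    have lim: "((\<lambda>t. inverse t *s (G t - a) + t ^ n *s c) \<longlongrightarrow> v + 0) (at 0)"
    proof (intro tendsto_add G(3) vec_tendstoI)
      fix j
      have "((\<lambda>t. t ^ n * c $ j) \<longlongrightarrow> 0 ^ n * c $ j) (at 0)" by (intro tendsto_intros)
      thus "((\<lambda>t. (t ^ n *s c) $ j) \<longlongrightarrow> 0 $ j) (at 0)" using Suc.hyps by (simp add: power_0_left)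
    qed
    have eq: "\<forall>\<^sub>F t in at 0. inverse t *s (G t - a) + t ^ n *s c = inverse t *s (?G t - a)"
      by (auto simp: eventually_at_filter vec_eq_iff field_simps)
    show "((\<lambda>t. inverse t *s (?G t - a)) \<longlongrightarrow> v) (at 0)"
      using lim unfolding tendsto_cong[OF eq] by (simp only: add_0_right)
    have lim: "((\<lambda>t. inverse (t ^ Suc n) *s (F (?G t) - F (G t) - A *v (t ^ Suc n *s c)) +
        inverse (t ^ Suc n) *s (F (G t) - G (lam * t)) - R) \<longlongrightarrow> 0 + R - R) (at 0)"
      using entire_curve_tendsto[OF G(1), of 0] G(2)
      by (intro tendsto_intros R strict_remainder_tendsto_0[OF F(1)]) auto
    have eq: "\<forall>\<^sub>F t in at 0. inverse (t ^ Suc n) *s (F (?G t) - F (G t) - A *v (t ^ Suc n *s c)) +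
        inverse (t ^ Suc n) *s (F (G t) - G (lam * t)) - R = inverse (t ^ Suc n) *s (F (?G t) - ?G (lam * t))"
    proof -
      have "inverse (t ^ Suc n) *s (F (?G t) - F (G t) - A *v (t ^ Suc n *s c)) +
          inverse (t ^ Suc n) *s (F (G t) - G (lam * t)) - R = inverse (t ^ Suc n) *s (F (?G t) - ?G (lam * t))"
        if "t \<noteq> 0" for t
        unfolding vec_eq_iff
        by (simp add: c[symmetric] vector_scalar_commute power_mult_distrib del: power_Suc)
           (use that in \<open>simp add: field_simps\<close>)
      thus ?thesis by (simp add: eventually_at_filter del: power_Suc)
    qed
    show "((\<lambda>t. inverse (t ^ Suc n) *s (F (?G t) - ?G (lam * t))) \<longlongrightarrow> 0) (at 0)"
      using lim unfolding tendsto_cong[OF eq] by (simp only: add_0_left diff_self)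
  qed
  thus ?case by blast
qed

section \<open>Points of the unstable manifold\<close>

text \<open>
The backward orbit is y(j) = lim F^i(x(j + i)). Passing from i to i + 1 introduces an error \<epsilon> \<theta>^(j+i), amplified
at most by L^i; as L \<theta> \<le> 1/2 these errors sum to at most 2 \<epsilon> \<theta>^j. The same bound keeps all points in the ball
on which L is a Lipschitz constant.
\<close>

lemma backward_orbit_shadowing:
  fixes F :: "'a::banach \<Rightarrow> 'a" and x :: "nat \<Rightarrow> 'a"
  assumes lip: "\<And>x y. x \<in> ball a \<delta> \<Longrightarrow> y \<in> ball a \<delta> \<Longrightarrow> norm (F x - F y) \<le> L * norm (x - y)"
    and const: "0 \<le> L" "0 \<le> \<theta>" "\<theta> \<le> 1" "L * \<theta> \<le> 1/2" "0 \<le> \<epsilon>" "2 * \<epsilon> < \<delta> / 2"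
    and x: "\<And>j. norm (x j - a) < \<delta> / 2"
    and pseudo: "\<And>j. norm (F (x (Suc j)) - x j) \<le> \<epsilon> * \<theta> ^ j"
  obtains y where "\<And>j. F (y (Suc j)) = y j" "\<And>j. norm (y j - x j) \<le> 2 * \<epsilon> * \<theta> ^ j"
proof -
  define Y where "Y i j = (F ^^ i) (x (j + i))" for i j
  have Y_Suc: "Y (Suc i) j = F (Y i (Suc j))" for i j by (simp add: Y_def)
  have le: "2 * \<epsilon> * \<theta> ^ j < \<delta> / 2" for j
    using const mult_left_mono[of "\<theta> ^ j" 1 "2 * \<epsilon>"] by (simp add: power_le_one)
  have \<delta>: "\<delta> > 0" using const by linarith
  have in_ball: "z \<in> ball a \<delta>" if "norm (z - x j) \<le> 2 * \<epsilon> * \<theta> ^ j" for z j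
  proof -
    have "norm (z - a) \<le> norm (z - x j) + norm (x j - a)"
      by (metis diff_add_cancel norm_triangle_ineq add_diff_eq)
    thus ?thesis using that le[of j] x[of j] by (simp add: dist_norm norm_minus_commute)
  qed
  have x_ball: "x j \<in> ball a \<delta>" for j using in_ball[of "x j" j] const by simp
  have contract: "L * (c * \<theta> ^ Suc j) \<le> c / 2 * \<theta> ^ j" if "c \<ge> 0" for c j
  proof -
    have "L * (c * \<theta> ^ Suc j) = (L * \<theta>) * (c * \<theta> ^ j)" by simp
    also have "\<dots> \<le> 1/2 * (c * \<theta> ^ j)" using that const by (intro mult_right_mono) auto
    finally show ?thesis by simp
  qed
  have near: "norm (Y i j - x j) \<le> 2 * \<epsilon> * \<theta> ^ j" for i j
  proof (induction i arbitrary: j)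
    case 0
    then show ?case using const by (simp add: Y_def)
  next
    case (Suc i)
    have "norm (Y (Suc i) j - x j) \<le> norm (F (Y i (Suc j)) - F (x (Suc j))) + norm (F (x (Suc j)) - x j)"
      unfolding Y_Suc by (metis diff_add_cancel norm_triangle_ineq add_diff_eq)
    also have "\<dots> \<le> L * norm (Y i (Suc j) - x (Suc j)) + \<epsilon> * \<theta> ^ j"
      by (intro add_mono lip pseudo in_ball[OF Suc.IH] x_ball)
    also have "\<dots> \<le> L * (2 * \<epsilon> * \<theta> ^ Suc j) + \<epsilon> * \<theta> ^ j"
      using const by (intro add_mono mult_left_mono Suc.IH) auto
    also have "\<dots> \<le> 2 * \<epsilon> * \<theta> ^ j" using contract[of "2 * \<epsilon>" j] const by simp
    finally show ?case .
  qed
  have step: "norm (Y (Suc i) j - Y i j) \<le> \<epsilon> * (1/2) ^ i * \<theta> ^ j" for i j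
  proof (induction i arbitrary: j)
    case 0
    then show ?case using pseudo by (simp add: Y_def)
  next
    case (Suc i)
    have "norm (Y (Suc (Suc i)) j - Y (Suc i) j) \<le> L * norm (Y (Suc i) (Suc j) - Y i (Suc j))"
      unfolding Y_Suc[of _ j] by (intro lip in_ball[OF near[of "Suc i" "Suc j"]] in_ball[OF near[of i "Suc j"]])
    also have "\<dots> \<le> L * (\<epsilon> * (1/2) ^ i * \<theta> ^ Suc j)" using const by (intro mult_left_mono Suc.IH) auto
    also have "\<dots> \<le> \<epsilon> * (1/2) ^ i / 2 * \<theta> ^ j" using const by (intro contract) auto
    finally show ?case by (simp add: field_simps)
  qed
  have "convergent (\<lambda>i. Y i j)" for j
  proof -
    have "summable (\<lambda>i. Y (Suc i) j - Y i j)"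
    proof (rule summable_comparison_test')
      show "summable (\<lambda>i. \<epsilon> * (1/2) ^ i * \<theta> ^ j)"
        by (intro summable_mult2 summable_mult summable_geometric) auto
    qed (use step in auto)
    hence "convergent (\<lambda>n. \<Sum>i<n. Y (Suc i) j - Y i j)" by (simp add: summable_iff_convergent)
    hence "convergent (\<lambda>n. Y n j - Y 0 j)" using sum_lessThan_telescope[of "\<lambda>i. Y i j"] by simp
    from convergent_add[OF this convergent_const[of "Y 0 j"]] show ?thesis by simp
  qed
  then obtain y where y: "\<And>j. (\<lambda>i. Y i j) \<longlonglongrightarrow> y j" unfolding convergent_def by metis
  have y_near: "norm (y j - x j) \<le> 2 * \<epsilon> * \<theta> ^ j" for j
  proof (rule Lim_bounded[where M = 0])
    show "(\<lambda>i. norm (Y i j - x j)) \<longlonglongrightarrow> norm (y j - x j)" by (intro tendsto_intros y)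
  qed (use near in auto)
  have "F (y (Suc j)) = y j" for j
  proof -
    have "(\<lambda>i. norm (F (Y i (Suc j)) - F (y (Suc j)))) \<longlonglongrightarrow> 0"
    proof (rule tendsto_sandwich[of "\<lambda>_. 0"])
      show "\<forall>\<^sub>F i in sequentially. norm (F (Y i (Suc j)) - F (y (Suc j))) \<le> L * norm (Y i (Suc j) - y (Suc j))"
        by (intro always_eventually allI lip in_ball[OF near] in_ball[OF y_near])
      have "(\<lambda>i. L * norm (Y i (Suc j) - y (Suc j))) \<longlonglongrightarrow> L * norm (y (Suc j) - y (Suc j))"
        by (intro tendsto_intros y)
      thus "(\<lambda>i. L * norm (Y i (Suc j) - y (Suc j))) \<longlonglongrightarrow> 0" by simp
    qed auto
    hence "(\<lambda>i. F (Y i (Suc j))) \<longlonglongrightarrow> F (y (Suc j))" using Lim_null tendsto_norm_zero_iff by blast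
    moreover have "(\<lambda>i. F (Y i (Suc j))) \<longlonglongrightarrow> y j"
      using LIMSEQ_Suc[OF y[of j]] by (simp add: Y_Suc)
    ultimately show ?thesis using LIMSEQ_unique by blast
  qed
  thus thesis using y_near that by blast
qed

text \<open>
The backward orbit shadowing G(t / \<lambda>^j) cannot be constant: it differs from G(t / \<lambda>^j) by at most a constant times
|t / \<lambda>^j|^n with n \<ge> 2, whereas the distance of G(t / \<lambda>^j) to \<open>a\<close> is of the order of |t / \<lambda>^j|.
\<close>

theorem unstable_manifold_nontrivial:
  fixes F :: "complex ^ 'n \<Rightarrow> complex ^ 'n"
  assumes F: "has_strict_derivative F (\<lambda>v. A *v v) a" "F a = a" "inj F"
    and entire: "\<And>G. entire_curve G \<Longrightarrow> entire_curve (\<lambda>t. F (G t))"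
    and lam: "cmod lam > 1" "det (mat lam - A) = 0"
    and det: "\<And>n. n \<ge> 2 \<Longrightarrow> det (mat (lam ^ n) - A) \<noteq> 0"
  shows "\<exists>z\<in>unstable_manifold F a. z \<noteq> a"
proof -
  have lam0: "lam \<noteq> 0" using lam(1) by auto
  obtain v where v: "v \<noteq> 0" "A *v v = lam *s v" using eigenvector_from_det[OF lam(2)] .
  obtain L \<delta> where L: "L > 0" "\<delta> > 0"
    "\<And>x y. x \<in> ball a \<delta> \<Longrightarrow> y \<in> ball a \<delta> \<Longrightarrow> norm (F x - F y) \<le> L * norm (x - y)"
    using has_strict_derivative_imp_Lipschitz[OF F(1)] by metis
  obtain n0 where n0: "2 * L < cmod lam ^ n0" using lam(1) real_arch_pow by blast
  \<comment> \<open>The exponent is at least 2, so that the shadowing error is of smaller order than the tangent vector.\<close>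
  define n where "n = n0 + 2"
  have n: "n \<ge> 2" by (simp add: n_def)
  have "cmod lam ^ n0 \<le> cmod lam ^ n" using lam(1) unfolding n_def by (intro power_increasing) auto
  hence nL: "2 * L < cmod lam ^ n" using n0 by linarith
  define \<theta> where "\<theta> = inverse (cmod lam ^ n)"
  have \<theta>: "0 \<le> \<theta>" "\<theta> \<le> 1" "L * \<theta> \<le> 1/2"
  proof -
    have "1 \<le> cmod lam ^ n" using lam(1) by (simp add: one_le_power)
    thus "0 \<le> \<theta>" "\<theta> \<le> 1" "L * \<theta> \<le> 1/2" using nL unfolding \<theta>_def by (auto simp: field_simps)
  qed
  obtain G where G: "entire_curve G" "G 0 = a" "((\<lambda>t. inverse t *s (G t - a)) \<longlongrightarrow> v) (at 0)"
     "((\<lambda>t. inverse (t ^ n) *s (F (G t) - G (lam * t))) \<longlongrightarrow> 0) (at 0)"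
    using approximate_unstable_curve_exists[OF F(1,2) entire v(2) det, of n] n
    unfolding approximate_unstable_curve_def by auto
  have "\<forall>\<^sub>F t in at 0. norm (G t - a) < \<delta> / 2"
    using tendstoD[OF entire_curve_tendsto[OF G(1), of 0], of "\<delta>/2"] L G(2) by (simp add: dist_norm)
  moreover have "\<forall>\<^sub>F t in at 0. norm (inverse (t ^ n) *s (F (G t) - G (lam * t))) < 1"
    using tendstoD[OF G(4), of 1] by simp
  ultimately have "\<forall>\<^sub>F t in at 0. norm (G t - a) < \<delta> / 2 \<and>
      norm (inverse (t ^ n) *s (F (G t) - G (lam * t))) < 1" by (rule eventually_conj)
  then obtain \<eta> where \<eta>: "\<eta> > 0" "\<And>t. t \<noteq> 0 \<Longrightarrow> cmod t < \<eta> \<Longrightarrow> norm (G t - a) < \<delta> / 2 \<and>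
      norm (inverse (t ^ n) *s (F (G t) - G (lam * t))) < 1"
    unfolding eventually_at by auto
  have err: "norm (F (G t) - G (lam * t)) \<le> cmod t ^ n" if "t \<noteq> 0" "cmod t < \<eta>" for t
    using \<eta>(2)[OF that] that(1) unfolding norm_vector_scalar_mult
    by (simp add: norm_divide norm_inverse norm_power field_simps)
  define t0 :: complex where "t0 = of_real (Min {\<eta>, 1, \<delta> / 4} / 2)"
  have t0: "t0 \<noteq> 0" "cmod t0 < \<eta>" "cmod t0 < 1" "cmod t0 < \<delta> / 4"
    using \<eta> L unfolding t0_def norm_of_real by (auto simp: min_def)
  define s where "s j = t0 / lam ^ j" for j
  have s: "s j \<noteq> 0" "cmod (s j) \<le> cmod t0" "lam * s (Suc j) = s j" for j
  proof -
    have "cmod lam ^ j \<ge> 1" using lam(1) by (simp add: one_le_power)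
    thus "cmod (s j) \<le> cmod t0" unfolding s_def
      by (simp add: norm_divide norm_power divide_le_eq mult_le_cancel_left1)
  qed (use t0 lam0 in \<open>auto simp: s_def\<close>)
  have s_eta: "cmod (s j) < \<eta>" for j using s(2)[of j] t0 by linarith
  have s_pow: "cmod (s j) ^ n = cmod t0 ^ n * \<theta> ^ j" for j
    by (simp add: s_def \<theta>_def norm_mult norm_inverse norm_power power_mult_distrib power_inverse
        divide_inverse power_mult[symmetric] mult.commute)
  have t0_pow: "cmod t0 ^ n \<le> cmod t0" using power_decreasing[of 1 n "cmod t0"] n t0 by simp
  obtain y where y: "\<And>j. F (y (Suc j)) = y j" "\<And>j. norm (y j - G (s j)) \<le> 2 * (cmod t0 ^ n) * \<theta> ^ j"
  proof (rule backward_orbit_shadowing[of a \<delta> F L \<theta> "cmod t0 ^ n" "\<lambda>j. G (s j)"])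
    fix j
    show "norm (G (s j) - a) < \<delta> / 2" using \<eta>(2) s s_eta by blast
    have "norm (F (G (s (Suc j))) - G (s j)) \<le> cmod (s (Suc j)) ^ n"
      using err[OF s(1) s_eta, of "Suc j"] s(3) by simp
    also have "\<dots> \<le> cmod t0 ^ n * \<theta> ^ j" unfolding s_pow
      using \<theta> by (intro mult_left_mono power_decreasing) auto
    finally show "norm (F (G (s (Suc j))) - G (s j)) \<le> cmod t0 ^ n * \<theta> ^ j" .
  qed (use L \<theta> t0 t0_pow in auto)
  have "s \<longlonglongrightarrow> 0"
  proof -
    have "(\<lambda>j. t0 * (inverse lam) ^ j) \<longlonglongrightarrow> t0 * 0"
      using lam by (intro tendsto_intros LIMSEQ_power_zero) (simp add: norm_inverse inverse_less_1_iff)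
    thus ?thesis by (simp add: s_def[abs_def] divide_inverse power_inverse)
  qed
  hence s_lim: "filterlim s (at 0) sequentially" using s(1) by (simp add: filterlim_at)
  have y_s: "norm (y j - G (s j)) \<le> 2 * cmod (s j) ^ n" for j
    using y(2)[of j] unfolding s_pow by simp
  have s_n_lim: "(\<lambda>j. 2 * cmod (s j) ^ n) \<longlonglongrightarrow> 0"
  proof -
    have "(\<lambda>j. 2 * cmod (s j) ^ n) \<longlonglongrightarrow> 2 * cmod 0 ^ n" by (intro tendsto_intros \<open>s \<longlonglongrightarrow> 0\<close>)
    thus ?thesis using n by (simp add: power_0_left)
  qed
  have "(\<lambda>j. y j - G (s j)) \<longlonglongrightarrow> 0"
    using y_s by (intro Lim_null_comparison[OF _ s_n_lim]) auto
  moreover have "(\<lambda>j. G (s j)) \<longlonglongrightarrow> a"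
    using filterlim_compose[OF entire_curve_tendsto[OF G(1), of 0] s_lim] G(2) by simp
  ultimately have "(\<lambda>j. (y j - G (s j)) + G (s j)) \<longlonglongrightarrow> 0 + a" by (rule tendsto_add)
  hence y_lim: "y \<longlonglongrightarrow> a" by simp
  have "(inv F ^^ j) (y 0) = y j" for j
  proof (induction j)
    case (Suc j)
    then show ?case using inv_f_eq[OF F(3) y(1)] by simp
  qed simp
  hence "y 0 \<in> unstable_manifold F a" unfolding unstable_manifold_def using y_lim by simp
  moreover have "y 0 \<noteq> a"
  proof
    assume "y 0 = a"
    have ya: "y j = a" for j
    proof (induction j)
      case (Suc j)
      hence "F (y (Suc j)) = F a" using y(1) F(2) by simp
      thus ?case using F(3) by (simp add: inj_eq)
    qed (rule \<open>y 0 = a\<close>)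
    have "(\<lambda>j. inverse (s j) *s (G (s j) - a)) \<longlonglongrightarrow> 0"
    proof (rule Lim_null_comparison)
      show "\<forall>\<^sub>F j in sequentially. norm (inverse (s j) *s (G (s j) - a)) \<le> 2 * cmod (s j)"
      proof (intro always_eventually allI)
        fix j
        have "norm (G (s j) - a) \<le> 2 * cmod (s j) ^ n" using y_s[of j] ya by (simp add: norm_minus_commute)
        also have "cmod (s j) ^ n \<le> cmod (s j) ^ 2"
          using n s(2)[of j] t0 by (intro power_decreasing) auto
        finally have "norm (G (s j) - a) \<le> 2 * cmod (s j) ^ 2" by simp
        thus "norm (inverse (s j) *s (G (s j) - a)) \<le> 2 * cmod (s j)"
          using s(1)[of j] unfolding norm_vector_scalar_mult
          by (simp add: norm_divide norm_inverse field_simps power2_eq_square)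
      qed
      have "(\<lambda>j. 2 * cmod (s j)) \<longlonglongrightarrow> 2 * cmod 0" by (intro tendsto_intros \<open>s \<longlonglongrightarrow> 0\<close>)
      thus "(\<lambda>j. 2 * cmod (s j)) \<longlonglongrightarrow> 0" by simp
    qed
    moreover have "(\<lambda>j. inverse (s j) *s (G (s j) - a)) \<longlonglongrightarrow> v"
      using filterlim_compose[OF G(3) s_lim] .
    ultimately show False using v(1) LIMSEQ_unique by blast
  qed
  ultimately show ?thesis by blast
qed

section \<open>Order and type from two-sided bounds\<close>

lemma norm_poly_le:
  fixes q :: "complex poly"
  obtains C where "C \<ge> 0" "\<And>z. cmod (poly q z) \<le> C * (1 + cmod z) ^ degree q"
proof
  show "(\<Sum>i\<le>degree q. cmod (coeff q i)) \<ge> 0" by (simp add: sum_nonneg)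
  fix z
  have "cmod (poly q z) \<le> (\<Sum>i\<le>degree q. cmod (coeff q i) * cmod z ^ i)"
    unfolding poly_altdef by (rule order_trans[OF norm_sum]) (simp add: norm_mult norm_power)
  also have "\<dots> \<le> (\<Sum>i\<le>degree q. cmod (coeff q i) * (1 + cmod z) ^ degree q)"
  proof (intro sum_mono mult_left_mono)
    fix i assume "i \<in> {..degree q}"
    have "cmod z ^ i \<le> (1 + cmod z) ^ i" by (intro power_mono) auto
    also have "\<dots> \<le> (1 + cmod z) ^ degree q" using \<open>i \<in> _\<close> by (intro power_increasing) auto
    finally show "cmod z ^ i \<le> (1 + cmod z) ^ degree q" .
  qed auto
  finally show "cmod (poly q z) \<le> (\<Sum>i\<le>degree q. cmod (coeff q i)) * (1 + cmod z) ^ degree q"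
    by (simp add: sum_distrib_right)
qed

lemma cmod_le_max_modulus:
  assumes "g holomorphic_on UNIV" "cmod z \<le> r"
  shows "cmod (g z) \<le> max_modulus g r"
proof -
  have r: "0 \<le> r" using assms(2) norm_ge_zero order_trans by blast
  have cont: "continuous_on UNIV g" using assms(1) holomorphic_on_imp_continuous_on by blast
  have bdd: "bdd_above ((\<lambda>w. cmod (g w)) ` sphere 0 r)"
    by (intro compact_imp_bounded[THEN bounded_imp_bdd_above] compact_continuous_image
        continuous_intros continuous_on_subset[OF cont]) auto
  show ?thesis
  proof (cases "cmod z = r")
    case True
    then show ?thesis unfolding max_modulus_def by (intro cSUP_upper bdd) auto
  next
    case False
    hence r': "0 < r" using assms(2) r by (cases "r = 0") auto
    show ?thesis
    proof (rule maximum_modulus_frontier[of g "cball 0 r"])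
      show "g holomorphic_on interior (cball 0 r)" using assms(1) holomorphic_on_subset by blast
      show "continuous_on (closure (cball 0 r)) g" using cont continuous_on_subset by blast
      fix w assume "w \<in> frontier (cball (0::complex) r)"
      then show "cmod (g w) \<le> max_modulus g r"
        unfolding max_modulus_def using r' by (intro cSUP_upper bdd) auto
    qed (use assms(2) in auto)
  qed
qed

lemma max_modulus_le:
  assumes "0 \<le> r" "\<And>z. cmod z = r \<Longrightarrow> cmod (g z) \<le> B"
  shows "max_modulus g r \<le> B"
  unfolding max_modulus_def using assms by (intro cSUP_least) auto

lemma le_Limsup_along_sequence:
  fixes X :: "real \<Rightarrow> ereal" and l :: ereal
  assumes "filterlim r at_top sequentially"
    and "eventually (\<lambda>n. b n \<le> X (r n)) sequentially" and "b \<longlonglongrightarrow> l"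
  shows "l \<le> Limsup at_top X"
proof (rule ccontr)
  assume "\<not> l \<le> Limsup at_top X"
  then obtain y where y: "Limsup at_top X < y" "y < l" using dense by (metis not_le)
  have "eventually (\<lambda>n. X (r n) < y) sequentially"
    using Limsup_lessD[OF y(1)] assms(1) by (rule eventually_compose_filterlim)
  moreover have "eventually (\<lambda>n. y < b n) sequentially"
    using assms(3) y(2) by (rule order_tendstoD)
  ultimately have "eventually (\<lambda>n. False) sequentially" using assms(2)
    by eventually_elim auto
  thus False by simp
qed

text \<open>
Order and type are upper limits, so a lower bound along one sequence of points suffices; the upper bound has to hold
everywhere.
\<close>

theorem order_and_type_from_bounds:
  fixes g :: "complex \<Rightarrow> complex" and s :: "nat \<Rightarrow> complex"
  assumes hol: "g holomorphic_on UNIV" and rho: "\<rho> > 0" and c: "c > 0"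
    and upper: "\<And>z. cmod z \<ge> 1 \<Longrightarrow> cmod (g z) \<le> exp (K * cmod z powr \<rho>)"
    and s: "filterlim (\<lambda>n. cmod (s n)) at_top sequentially"
    and lower: "eventually (\<lambda>n. exp (c * cmod (s n) powr \<rho>) \<le> cmod (g (s n))) sequentially"
  shows "transcendental_entire g" "entire_order g = ereal \<rho>" "mean_type g"
proof -
  let ?M = "max_modulus g"
  have M_upper: "?M r \<le> exp (K * r powr \<rho>)" if "r \<ge> 1" for r
    using upper that by (intro max_modulus_le) auto
  have M_lower: "eventually (\<lambda>n. exp (c * cmod (s n) powr \<rho>) \<le> ?M (cmod (s n))) sequentially"
    using lower by eventually_elim (use cmod_le_max_modulus[OF hol] order_trans in blast)
  have s_gt: "eventually (\<lambda>n. cmod (s n) > B) sequentially" for B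
    using s by (simp add: filterlim_at_top_dense)
  have powr_top: "filterlim (\<lambda>r::real. c * r powr \<rho>) at_top at_top"
    using rho c by real_asymp
  have "filterlim (\<lambda>n. c * cmod (s n) powr \<rho>) at_top sequentially"
    using filterlim_compose[OF powr_top s] .
  hence ev1: "eventually (\<lambda>n. c * cmod (s n) powr \<rho> \<ge> 1) sequentially"
    by (simp add: filterlim_at_top)
  obtain n where n: "c * cmod (s n) powr \<rho> \<ge> 1" "exp (c * cmod (s n) powr \<rho>) \<le> cmod (g (s n))"
    using eventually_happens'[OF _ eventually_conj[OF ev1 lower]] by auto
  \<comment> \<open>By the maximum principle one large value makes the maximum modulus large on all later circles, so
     both logarithms are taken of positive numbers.\<close>
  have "exp 1 \<le> ?M r" if "r \<ge> cmod (s n)" for r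
  proof -
    have "exp 1 \<le> cmod (g (s n))" using n order_trans exp_le_cancel_iff by blast
    also have "\<dots> \<le> ?M r" using that by (rule cmod_le_max_modulus[OF hol])
    finally show ?thesis .
  qed
  hence lnM_ge: "ln (?M r) \<ge> 1" if "r \<ge> cmod (s n)" for r
    using that by (metis exp_gt_zero ln_exp ln_le_cancel_iff order_less_le_trans)
  have ev_ge: "eventually (\<lambda>r. r \<ge> max (cmod (s n)) 2) at_top"
    by (rule eventually_ge_at_top)
  have lnM_le: "ln (?M r) \<le> K * r powr \<rho>" if "r \<ge> max (cmod (s n)) 2" for r
  proof -
    have "?M r > 0" using \<open>\<And>r. r \<ge> cmod (s n) \<Longrightarrow> exp 1 \<le> ?M r\<close>[of r] that
      by (meson exp_gt_zero max.bounded_iff order_less_le_trans)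
    thus ?thesis using M_upper[of r] that by (metis exp_gt_zero ln_exp ln_le_cancel_iff max.bounded_iff
         one_le_numeral order_trans)
  qed
  have K: "K > 0"
  proof (rule ccontr)
    assume "\<not> K > 0"
    hence "K * r powr \<rho> \<le> 0" for r by (simp add: mult_nonpos_nonneg)
    thus False using lnM_le[of "max (cmod (s n)) 2"] lnM_ge[of "max (cmod (s n)) 2"]
      by (smt (verit) max.cobounded1)
  qed
  have up: "Limsup at_top (\<lambda>r. ereal (ln (ln (?M r)) / ln r)) \<le> ereal \<rho>"
  proof -
    have "Limsup at_top (\<lambda>r. ereal (ln (ln (?M r)) / ln r)) \<le> Limsup at_top (\<lambda>r. ereal (ln K / ln r + \<rho>))"
    proof (rule Limsup_mono, rule eventually_mono[OF ev_ge])
      fix r assume r: "max (cmod (s n)) 2 \<le> r"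
      hence "ln (ln (?M r)) \<le> ln (K * r powr \<rho>)"
        using lnM_ge[of r] lnM_le[of r] by (intro ln_mono) auto
      also have "\<dots> = ln K + \<rho> * ln r" using K r by (simp add: ln_mult ln_powr)
      finally have "ln (ln (?M r)) / ln r \<le> (ln K + \<rho> * ln r) / ln r"
        using r by (intro divide_right_mono) auto
      also have "\<dots> = ln K / ln r + \<rho>" using r by (simp add: add_divide_distrib)
      finally show "ereal (ln (ln (?M r)) / ln r) \<le> ereal (ln K / ln r + \<rho>)" by simp
    qed
    also have "\<dots> = ereal \<rho>"
    proof (rule lim_imp_Limsup)
      have "((\<lambda>r::real. ln K / ln r + \<rho>) \<longlongrightarrow> \<rho>) at_top" by real_asymp
      thus "((\<lambda>r::real. ereal (ln K / ln r + \<rho>)) \<longlongrightarrow> ereal \<rho>) at_top" by simp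
    qed simp
    finally show ?thesis .
  qed
  have lo: "ereal \<rho> \<le> Limsup at_top (\<lambda>r. ereal (ln (ln (?M r)) / ln r))"
  proof (rule le_Limsup_along_sequence[OF s])
    show "eventually (\<lambda>n. ereal (ln c / ln (cmod (s n)) + \<rho>) \<le>
            ereal (ln (ln (?M (cmod (s n)))) / ln (cmod (s n)))) sequentially"
      using M_lower ev1 s_gt[of 2]
    proof eventually_elim
      case (elim n)
      have "c * cmod (s n) powr \<rho> \<le> ln (?M (cmod (s n)))"
        using elim(1) by (metis exp_gt_zero ln_exp ln_le_cancel_iff order_less_le_trans)
      hence "ln (c * cmod (s n) powr \<rho>) \<le> ln (ln (?M (cmod (s n))))"
        using elim by (intro ln_mono) auto
      moreover have "ln (c * cmod (s n) powr \<rho>) = ln c + \<rho> * ln (cmod (s n))"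
        using c elim by (subst ln_mult) (auto simp: ln_powr)
      ultimately have "(ln c + \<rho> * ln (cmod (s n))) / ln (cmod (s n)) \<le>
           ln (ln (?M (cmod (s n)))) / ln (cmod (s n))"
        using elim by (intro divide_right_mono) auto
      moreover have "ln (cmod (s n)) > 0" using elim by (intro ln_gt_zero) linarith
      ultimately show ?case by (simp add: add_divide_distrib)
    qed
    have "((\<lambda>r::real. ln c / ln r + \<rho>) \<longlongrightarrow> \<rho>) at_top" by real_asymp
    from filterlim_compose[OF this s]
    show "(\<lambda>n. ereal (ln c / ln (cmod (s n)) + \<rho>)) \<longlonglongrightarrow> ereal \<rho>" by simp
  qed
  show order: "entire_order g = ereal \<rho>"
    unfolding entire_order_def using up lo by (rule antisym)
  have "entire_type g \<le> Limsup at_top (\<lambda>r::real. ereal K)"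
    unfolding entire_type_def order
  proof (rule Limsup_mono, rule eventually_mono[OF ev_ge])
    fix r assume r: "max (cmod (s n)) 2 \<le> r"
    have "r powr (-\<rho>) * ln (?M r) \<le> r powr (-\<rho>) * (K * r powr \<rho>)"
      using lnM_le[OF r] by (intro mult_left_mono) auto
    also have "\<dots> = K" using r by (simp add: powr_minus field_simps)
    finally show "ereal (r powr (- real_of_ereal (ereal \<rho>)) * ln (?M r)) \<le> ereal K" by simp
  qed
  hence t1: "entire_type g \<le> ereal K" by (simp add: Limsup_const)
  have t2: "ereal c \<le> entire_type g"
    unfolding entire_type_def order
  proof (rule le_Limsup_along_sequence[OF s])
    show "eventually (\<lambda>n. ereal c \<le>
       ereal (cmod (s n) powr (- real_of_ereal (ereal \<rho>)) * ln (?M (cmod (s n))))) sequentially"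
      using M_lower s_gt[of 2]
    proof eventually_elim
      case (elim n)
      have "c * cmod (s n) powr \<rho> \<le> ln (?M (cmod (s n)))"
        using elim(1) by (metis exp_gt_zero ln_exp ln_le_cancel_iff order_less_le_trans)
      hence "cmod (s n) powr (-\<rho>) * (c * cmod (s n) powr \<rho>) \<le> cmod (s n) powr (-\<rho>) * ln (?M (cmod (s n)))"
        by (intro mult_left_mono) auto
      moreover have "cmod (s n) powr (-\<rho>) * (c * cmod (s n) powr \<rho>) = c"
        using less_trans[OF _ elim(2), of 0] by (simp add: powr_minus field_simps)
      ultimately show ?case by simp
    qed
  qed simp
  show "mean_type g" unfolding mean_type_def order
    using rho c t1 t2 by (auto simp: zero_ereal_def intro: order.strict_trans1 order.strict_trans2
      less_le_trans[of _ "ereal c"] le_less_trans[of _ "ereal K"])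
  show "transcendental_entire g" unfolding transcendental_entire_def
  proof (intro conjI hol notI)
    assume "\<exists>q. \<forall>z. g z = poly q z"
    then obtain q where q: "\<And>z. g z = poly q z" by auto
    obtain C where C: "C \<ge> 0" "\<And>z. cmod (poly q z) \<le> C * (1 + cmod z) ^ degree q"
      by (rule norm_poly_le) blast
    have "filterlim (\<lambda>r::real. exp (c * r powr \<rho>) / (1 + r) ^ degree q) at_top at_top"
      using c rho by real_asymp
    from filterlim_compose[OF this s]
    have "eventually (\<lambda>n. exp (c * cmod (s n) powr \<rho>) / (1 + cmod (s n)) ^ degree q > C) sequentially"
      by (simp add: filterlim_at_top_dense)
    with lower have "eventually (\<lambda>n. False) sequentially"
    proof eventually_elim
      case (elim n)
      have "exp (c * cmod (s n) powr \<rho>) > C * (1 + cmod (s n)) ^ degree q"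
        using elim(2) by (simp add: field_simps add_pos_nonneg)
      with elim(1) C(2)[of "s n"] show False by (simp add: q)
    qed
    thus False by simp
  qed
qed

section \<open>Elementary properties of generalized Henon maps\<close>

lemma tuple_nth:
  fixes e :: "nat \<Rightarrow> 'k::finite"
  assumes "bij_betw e {1..CARD('k)} UNIV" "i \<in> {1..CARD('k)}"
  shows "tuple e f $ e i = f i"
  using assms by (simp add: tuple_def bij_betw_def inv_into_f_f)

lemma coordinate_cases:
  fixes e :: "nat \<Rightarrow> 'k::finite"
  assumes "bij_betw e {1..CARD('k)} UNIV"
  obtains i where "i < CARD('k)" "j = e (Suc i)"
proof -
  obtain i where "i \<in> {1..CARD('k)}" "j = e i"
    using assms unfolding bij_betw_def by (metis UNIV_I image_iff)
  thus thesis by (intro that[of "i - 1"]) auto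
qed

lemma henon_step_nth:
  fixes e :: "nat \<Rightarrow> 'k::finite"
  assumes "bij_betw e {1..CARD('k)} UNIV" "i < CARD('k)"
  shows "henon_step e \<alpha> p z $ e (Suc i) =
     (if Suc i < CARD('k) then z $ e (Suc (Suc i)) else \<alpha> * z $ e 1 + poly p (z $ e CARD('k)))"
  unfolding henon_step_def by (subst tuple_nth[OF assms(1)]) (use assms(2) in auto)

lemma inj_henon_step:
  fixes e :: "nat \<Rightarrow> 'k::finite"
  assumes bij: "bij_betw e {1..CARD('k)} UNIV" and k: "CARD('k) \<ge> 2" and "\<alpha> \<noteq> 0"
  shows "inj (henon_step e \<alpha> p)"
proof (rule injI)
  fix z w assume eq: "henon_step e \<alpha> p z = henon_step e \<alpha> p w"
  have shift: "z $ e (Suc (Suc i)) = w $ e (Suc (Suc i))" if "Suc i < CARD('k)" for i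
    using henon_step_nth[OF bij, of i] eq that by (metis Suc_lessD)
  have last: "z $ e CARD('k) = w $ e CARD('k)"
    using shift[of "CARD('k) - 2"] k by (simp add: numeral_2_eq_2 Suc_diff_Suc)
  have "\<alpha> * z $ e 1 + poly p (z $ e CARD('k)) = \<alpha> * w $ e 1 + poly p (w $ e CARD('k))"
    using henon_step_nth[OF bij, of "CARD('k) - 1" \<alpha> p] eq k
    by (metis Suc_diff_1 diff_less less_irrefl_nat zero_less_card_finite zero_less_one)
  hence first: "z $ e 1 = w $ e 1" using last \<open>\<alpha> \<noteq> 0\<close> by simp
  show "z = w"
  proof (rule vec_eq_iff[THEN iffD2], rule allI)
    fix j
    obtain i where "i < CARD('k)" "j = e (Suc i)" using coordinate_cases[OF bij] .
    thus "z $ j = w $ j" using shift first by (cases i) auto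
  qed
qed

lemma inj_henon_comp:
  fixes e :: "nat \<Rightarrow> 'k::finite"
  assumes "bij_betw e {1..CARD('k)} UNIV" "CARD('k) \<ge> 2" "\<forall>i\<in>{1..n}. \<alpha> i \<noteq> 0"
  shows "inj (henon_comp e \<alpha> p n)"
  using assms(3)
  by (induction n) (auto intro!: inj_compose inj_henon_step[OF assms(1,2)] simp del: comp_apply)

lemma has_strict_derivative_henon_step:
  fixes e :: "nat \<Rightarrow> 'k::finite"
  assumes bij: "bij_betw e {1..CARD('k)} UNIV"
  shows "\<exists>F'. has_strict_derivative (henon_step e \<alpha> p) F' a"
proof -
  have nth: "has_strict_derivative (\<lambda>z::complex^'k. z $ j) (\<lambda>z. z $ j) a" for j
    by (intro has_strict_derivative_linear bounded_linear_vec_nth)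
  have "\<exists>F'. has_strict_derivative (\<lambda>z. henon_step e \<alpha> p z $ j) F' a" for j
  proof -
    obtain i where i: "i < CARD('k)" "j = e (Suc i)" using coordinate_cases[OF bij] .
    show ?thesis
    proof (cases "Suc i < CARD('k)")
      case True
      then show ?thesis using nth i by (auto simp: henon_step_nth[OF bij])
    next
      case False
      have "has_strict_derivative (\<lambda>z::complex^'k. \<alpha> * z $ e 1) (\<lambda>z. \<alpha> * z $ e 1) a"
        by (intro has_strict_derivative_linear bounded_linear_const_mult bounded_linear_vec_nth)
      from has_strict_derivative_add[OF this has_strict_derivative_compose[OF nth has_strict_derivative_poly]]
      show ?thesis using False i by (auto simp: henon_step_nth[OF bij])
    qed
  qed
  then obtain F' where "\<And>j. has_strict_derivative (\<lambda>z. henon_step e \<alpha> p z $ j) (F' j) a" by metis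
  thus ?thesis using has_strict_derivative_vec by blast
qed

lemma has_strict_derivative_henon_comp:
  fixes e :: "nat \<Rightarrow> 'k::finite"
  assumes bij: "bij_betw e {1..CARD('k)} UNIV"
  shows "\<exists>F'. has_strict_derivative (henon_comp e \<alpha> p n) F' a"
proof (induction n)
  case 0
  have "has_strict_derivative (id :: complex ^ 'k \<Rightarrow> _) id a"
    unfolding id_def by (intro has_strict_derivative_linear bounded_linear_ident)
  thus ?case unfolding henon_comp.simps(1) by (rule exI[of _ id])
next
  case (Suc n)
  then obtain F' where "has_strict_derivative (henon_comp e \<alpha> p n) F' a" by blast
  moreover obtain G' where "has_strict_derivative (henon_step e (\<alpha> (Suc n)) (p (Suc n))) G' (henon_comp e \<alpha> p n a)"
    using has_strict_derivative_henon_step[OF bij] by blast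
  ultimately show ?case
    unfolding henon_comp.simps(2) comp_def by (intro exI) (rule has_strict_derivative_compose)
qed

lemma entire_curve_henon_step:
  fixes e :: "nat \<Rightarrow> 'k::finite"
  assumes bij: "bij_betw e {1..CARD('k)} UNIV" and G: "entire_curve G"
  shows "entire_curve (\<lambda>t. henon_step e \<alpha> p (G t))"
  unfolding entire_curve_def
proof
  fix j
  obtain i where i: "i < CARD('k)" "j = e (Suc i)" using coordinate_cases[OF bij] .
  have "(\<lambda>t. \<alpha> * G t $ e 1 + poly p (G t $ e CARD('k))) holomorphic_on UNIV"
    using G unfolding entire_curve_def poly_altdef by (auto intro!: holomorphic_intros)
  thus "(\<lambda>t. henon_step e \<alpha> p (G t) $ j) holomorphic_on UNIV"
    using G i by (cases "Suc i < CARD('k)") (auto simp: henon_step_nth[OF bij] entire_curve_def)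
qed

lemma entire_curve_henon_comp:
  fixes e :: "nat \<Rightarrow> 'k::finite"
  assumes "bij_betw e {1..CARD('k)} UNIV" "entire_curve G"
  shows "entire_curve (\<lambda>t. henon_comp e \<alpha> p n (G t))"
  by (induction n) (use assms in \<open>auto intro: entire_curve_henon_step\<close>)

section \<open>Upper bound for the growth of the parametrization\<close>

lemma henon_step_growth:
  fixes e :: "nat \<Rightarrow> 'k::finite"
  assumes bij: "bij_betw e {1..CARD('k)} UNIV" and deg: "degree p \<ge> 1"
  shows "\<exists>C\<ge>1. \<forall>z. 1 + norm (henon_step e \<alpha> p z) \<le> C * (1 + norm z) ^ degree p"
proof -
  obtain C where C: "C \<ge> 0" "\<And>z. cmod (poly p z) \<le> C * (1 + cmod z) ^ degree p"
    by (rule norm_poly_le) blast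
  let ?D = "1 + cmod \<alpha> + C"
  show ?thesis
  proof (intro exI[of _ "1 + CARD('k) * ?D"] conjI allI)
    show "1 \<le> 1 + CARD('k) * ?D" using C by simp
    fix z :: "complex ^ 'k"
    let ?N = "(1 + norm z) ^ degree p"
    have N: "1 + norm z \<le> ?N" using power_increasing[OF deg, of "1 + norm z"] by simp
    have comp: "norm (henon_step e \<alpha> p z $ j) \<le> ?D * ?N" for j
    proof -
      obtain i where i: "i < CARD('k)" "j = e (Suc i)" using coordinate_cases[OF bij] .
      have le: "cmod (z $ l) \<le> ?N" for l using Finite_Cartesian_Product.norm_nth_le[of z l] N by linarith
      have "cmod (poly p (z $ e CARD('k))) \<le> C * (1 + cmod (z $ e CARD('k))) ^ degree p" by (rule C)
      also have "\<dots> \<le> C * ?N"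
        using C by (intro mult_left_mono power_mono add_mono Finite_Cartesian_Product.norm_nth_le) auto
      finally have "cmod (poly p (z $ e CARD('k))) \<le> C * ?N" .
      moreover have "cmod (\<alpha> * z $ e 1) \<le> cmod \<alpha> * ?N" by (simp add: norm_mult mult_left_mono le)
      ultimately have "cmod (\<alpha> * z $ e 1 + poly p (z $ e CARD('k))) \<le> cmod \<alpha> * ?N + C * ?N"
        using norm_triangle_mono by blast
      also have "\<dots> \<le> ?D * ?N" using N by (simp add: algebra_simps)
      finally have 1: "cmod (\<alpha> * z $ e 1 + poly p (z $ e CARD('k))) \<le> ?D * ?N" .
      have "cmod (z $ l) \<le> ?D * ?N" for l
      proof -
        have "1 * ?N \<le> ?D * ?N" using C N by (intro mult_right_mono) auto
        thus ?thesis using le[of l] by simp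
      qed
      with 1 show ?thesis using i by (simp add: henon_step_nth[OF bij])
    qed
    have "norm (henon_step e \<alpha> p z) \<le> (\<Sum>j\<in>UNIV. norm (henon_step e \<alpha> p z $ j))"
      unfolding norm_vec_def by (rule L2_set_le_sum) auto
    also have "\<dots> \<le> (\<Sum>j\<in>(UNIV::'k set). ?D * ?N)" by (intro sum_mono comp)
    finally have "norm (henon_step e \<alpha> p z) \<le> CARD('k) * (?D * ?N)" by simp
    moreover have "1 \<le> ?N" using N by (smt (verit) norm_ge_zero)
    moreover have "(1 + CARD('k) * ?D) * ?N = ?N + CARD('k) * (?D * ?N)" by (simp add: algebra_simps)
    ultimately show "1 + norm (henon_step e \<alpha> p z) \<le> (1 + CARD('k) * ?D) * ?N" by linarith
  qed
qed

lemma henon_comp_growth: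
  fixes e :: "nat \<Rightarrow> 'k::finite"
  assumes bij: "bij_betw e {1..CARD('k)} UNIV" and "\<forall>i\<in>{1..n}. degree (p i) \<ge> 1"
  shows "\<exists>C\<ge>1. \<forall>z. 1 + norm (henon_comp e \<alpha> p n z) \<le> C * (1 + norm z) ^ (\<Prod>i=1..n. degree (p i))"
  using assms(2)
proof (induction n)
  case 0
  show ?case by (intro exI[of _ 1]) auto
next
  case (Suc n)
  let ?D = "\<Prod>i=1..n. degree (p i)" and ?q = "degree (p (Suc n))"
  obtain C1 where C1: "C1 \<ge> 1" "\<And>z. 1 + norm (henon_comp e \<alpha> p n z) \<le> C1 * (1 + norm z) ^ ?D"
    using Suc by auto
  obtain C2 where C2: "C2 \<ge> 1" "\<And>z. 1 + norm (henon_step e (\<alpha> (Suc n)) (p (Suc n)) z) \<le> C2 * (1 + norm z) ^ ?q"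
    using henon_step_growth[OF bij, of "p (Suc n)" "\<alpha> (Suc n)"] Suc.prems by auto
  show ?case
  proof (intro exI[of _ "C2 * C1 ^ ?q"] conjI allI)
    show "1 \<le> C2 * C1 ^ ?q" using C1 C2 mult_mono[of 1 C2 1 "C1 ^ ?q"] by (simp add: one_le_power)
    fix z
    have "1 + norm (henon_comp e \<alpha> p (Suc n) z) \<le> C2 * (1 + norm (henon_comp e \<alpha> p n z)) ^ ?q"
      using C2(2) by simp
    also have "\<dots> \<le> C2 * (C1 * (1 + norm z) ^ ?D) ^ ?q"
      using C1 C2 by (intro mult_left_mono power_mono) auto
    also have "\<dots> = C2 * C1 ^ ?q * (1 + norm z) ^ (\<Prod>i=1..Suc n. degree (p i))"
      by (simp add: power_mult_distrib power_mult[symmetric])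
    finally show "1 + norm (henon_comp e \<alpha> p (Suc n) z) \<le> C2 * C1 ^ ?q * (1 + norm z) ^ (\<Prod>i=1..Suc n. degree (p i))" .
  qed
qed

lemma power_powr_log_ratio:
  fixes b d :: real
  assumes "b > 1" "d > 0"
  shows "(b ^ n) powr (ln d / ln b) = d ^ n"
proof -
  have "(b ^ n) powr (ln d / ln b) = exp (real n * ln d)"
    using assms by (simp add: powr_def ln_realpow)
  also have "\<dots> = d ^ n" using assms by (simp add: exp_of_nat_mult)
  finally show ?thesis .
qed

text \<open>
The quantity C (1 + |H(t)|) is at most raised to the power d when t is multiplied by \<lambda>. Every t with
|t| \<ge> 1 is \<lambda>^n s with |s| \<le> |\<lambda>| and |\<lambda>|^n \<le> |t|, and then d^n \<le> |t|^\<rho>.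
\<close>

lemma curve_growth_from_functional_equation:
  fixes H :: "complex \<Rightarrow> complex ^ 'k"
  assumes H: "entire_curve H" "\<And>t. F (H t) = H (lam * t)" and lam: "cmod lam > 1" and d: "d \<ge> 2"
    and C: "C \<ge> 1" "\<And>z. 1 + norm (F z) \<le> C * (1 + norm z) ^ d"
  obtains K where "\<And>t. cmod t \<ge> 1 \<Longrightarrow> norm (H t) \<le> exp (K * cmod t powr (ln (real d) / ln (cmod lam)))"
proof -
  have "continuous_on UNIV H"
    using entire_curve_tendsto[OF H(1)] by (simp add: continuous_on_def)
  hence "bounded (H ` cball 0 (cmod lam))"
    by (intro compact_imp_bounded compact_continuous_image) (auto intro: continuous_on_subset)
  then obtain B where B: "\<And>s. cmod s \<le> cmod lam \<Longrightarrow> norm (H s) \<le> B"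
    unfolding bounded_iff by (metis imageI mem_cball_0)
  have B0: "B \<ge> 0" using B[of 0] by (smt (verit) norm_ge_zero norm_zero)
  define K where "K = ln (C * (1 + B))"
  have CB: "C * (1 + B) \<ge> 1" using C B0 mult_mono[of 1 C 1 "1 + B"] by simp
  have iter: "C * (1 + norm (H (lam ^ n * s))) \<le> (C * (1 + B)) ^ (d ^ n)" if "cmod s \<le> cmod lam" for n s
  proof (induction n)
    case 0
    show ?case using B[OF that] C by simp
  next
    case (Suc n)
    let ?u = "norm (H (lam ^ n * s))"
    have "C * (1 + norm (H (lam ^ Suc n * s))) = C * (1 + norm (F (H (lam ^ n * s))))"
      using H(2) by (simp add: mult.assoc)
    also have "\<dots> \<le> C * (C * (1 + ?u) ^ d)" using C by (intro mult_left_mono) auto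
    also have "\<dots> = C ^ 2 * (1 + ?u) ^ d" by (simp add: power2_eq_square)
    also have "\<dots> \<le> C ^ d * (1 + ?u) ^ d" using C d by (intro mult_right_mono power_increasing) auto
    also have "\<dots> = (C * (1 + ?u)) ^ d" by (simp add: power_mult_distrib)
    also have "\<dots> \<le> ((C * (1 + B)) ^ (d ^ n)) ^ d" using C by (intro power_mono Suc.IH) auto
    also have "\<dots> = (C * (1 + B)) ^ (d ^ Suc n)" by (simp add: power_mult[symmetric] mult.commute)
    finally show ?case .
  qed
  have "norm (H t) \<le> exp (K * cmod t powr (ln (real d) / ln (cmod lam)))" if t: "cmod t \<ge> 1" for t
  proof -
    define n' where "n' = (LEAST n. cmod t < cmod lam ^ n)"
    have n': "cmod t < cmod lam ^ n'" unfolding n'_def using real_arch_pow[OF lam] by (rule LeastI_ex)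
    hence "n' \<noteq> 0" using t by (intro notI) simp
    then obtain n where n: "n' = Suc n" using not0_implies_Suc by blast
    hence le: "cmod lam ^ n \<le> cmod t" using not_less_Least[of n "\<lambda>n. cmod t < cmod lam ^ n"]
      unfolding n'_def by (metis lessI not_le)
    define s where "s = t / lam ^ n"
    have lam0: "lam \<noteq> 0" using lam by auto
    have ts: "t = lam ^ n * s" using lam0 by (simp add: s_def)
    have "cmod s \<le> cmod lam"
      using n' lam0 n unfolding s_def by (simp add: norm_divide norm_power pos_divide_le_eq)
    have "norm (H t) \<le> C * (1 + norm (H t))" using C mult_mono[of 1 C "norm (H t)" "1 + norm (H t)"] by simp
    also have "\<dots> \<le> (C * (1 + B)) ^ (d ^ n)" unfolding ts by (rule iter) fact
    also have "\<dots> = exp (K * real d ^ n)" using CB unfolding K_def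
      by (metis exp_ln exp_of_nat2_mult less_le_trans of_nat_power zero_less_one)
    also have "\<dots> \<le> exp (K * cmod t powr (ln (real d) / ln (cmod lam)))"
    proof -
      have "real d ^ n = (cmod lam ^ n) powr (ln (real d) / ln (cmod lam))"
        using power_powr_log_ratio lam d by simp
      also have "\<dots> \<le> cmod t powr (ln (real d) / ln (cmod lam))"
        using le lam d by (intro powr_mono2) auto
      finally show ?thesis using CB unfolding K_def by (simp add: mult_left_mono)
    qed
    finally show ?thesis .
  qed
  thus thesis by (rule that)
qed

section \<open>Escaping orbits\<close>

text \<open>
As the degree is at least 2, the linear term and the lower terms of q are together at most S |z|^(degree q - 1).
B is chosen so that for |z| \<ge> exp B this is at most half of the leading term, and that exp (-B) is at most
half of the absolute value of the leading coefficient.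
\<close>

lemma poly_dominates_linear_term:
  fixes q :: "complex poly"
  assumes deg: "degree q \<ge> 2"
  shows "\<exists>B\<ge>0. \<forall>z w. exp B \<le> cmod z \<longrightarrow> cmod w \<le> cmod z \<longrightarrow>
           exp (- B) * cmod z ^ degree q \<le> cmod (\<alpha> * w + poly q z)"
proof -
  define S where "S = (\<Sum>i<degree q. cmod (coeff q i)) + cmod \<alpha>"
  define l where "l = cmod (lead_coeff q)"
  have l: "l > 0" using deg by (auto simp: l_def)
  have S: "S \<ge> 0" unfolding S_def by (simp add: sum_nonneg)
  define B where "B = ln (1 + 2 / l + 2 * S / l)"
  have "1 + 2 / l + 2 * S / l \<ge> 1" using l S by simp
  hence expB: "exp B = 1 + 2 / l + 2 * S / l" "B \<ge> 0" unfolding B_def by (simp, intro ln_ge_zero)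
  have "exp (- B) \<le> l / 2"
  proof -
    have "2 / l \<le> exp B" using l S expB by simp
    thus ?thesis using l by (simp add: exp_minus field_simps)
  qed
  show ?thesis
  proof (intro exI[of _ B] conjI allI impI)
    fix z w assume z: "exp B \<le> cmod z" and w: "cmod w \<le> cmod z"
    have z1: "cmod z \<ge> 1" using z expB(2) by (meson one_le_exp_iff order_trans)
    have "2 * S / l \<le> exp B" using l expB by simp
    hence "2 * S / l \<le> cmod z" using z by (rule order_trans)
    hence z2: "2 * S \<le> l * cmod z" using l by (simp add: pos_divide_le_eq mult.commute)
    let ?n = "degree q - 1"
    have n: "degree q = Suc ?n" using deg by simp
    have "cmod (\<Sum>i<degree q. coeff q i * z ^ i) \<le> (\<Sum>i<degree q. cmod (coeff q i) * cmod z ^ ?n)"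
    proof (rule order_trans[OF norm_sum], rule sum_mono)
      fix i assume "i \<in> {..<degree q}"
      hence "cmod z ^ i \<le> cmod z ^ ?n" using z1 by (intro power_increasing) auto
      thus "cmod (coeff q i * z ^ i) \<le> cmod (coeff q i) * cmod z ^ ?n"
        by (simp add: norm_mult norm_power mult_left_mono)
    qed
    moreover have "cmod (\<alpha> * w) \<le> cmod \<alpha> * cmod z ^ ?n"
    proof -
      have "cmod z ^ 1 \<le> cmod z ^ ?n" using z1 deg by (intro power_increasing) auto
      thus ?thesis using w by (simp add: norm_mult mult_left_mono)
    qed
    ultimately have rest: "cmod (\<alpha> * w + (\<Sum>i<degree q. coeff q i * z ^ i)) \<le> S * cmod z ^ ?n"
      unfolding S_def by (intro norm_triangle_le) (simp add: algebra_simps sum_distrib_left)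
    have "poly q z = (\<Sum>i<degree q. coeff q i * z ^ i) + lead_coeff q * z ^ degree q"
      unfolding poly_altdef by (simp add: lessThan_Suc_atMost[symmetric])
    hence eq: "\<alpha> * w + poly q z = lead_coeff q * z ^ degree q + (\<alpha> * w + (\<Sum>i<degree q. coeff q i * z ^ i))"
      by simp
    have "exp (- B) * cmod z ^ degree q \<le> l / 2 * cmod z ^ degree q"
      using \<open>exp (- B) \<le> l / 2\<close> by (intro mult_right_mono) auto
    also have "\<dots> = l * cmod z ^ degree q - (l * cmod z) / 2 * cmod z ^ ?n"
      by (subst (1 2 3) n) (simp add: field_simps)
    also have "\<dots> \<le> l * cmod z ^ degree q - S * cmod z ^ ?n"
      using z2 by (intro diff_left_mono mult_right_mono) auto
    also have "\<dots> \<le> cmod (lead_coeff q * z ^ degree q) - cmod (\<alpha> * w + (\<Sum>i<degree q. coeff q i * z ^ i))"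
      using rest by (simp add: norm_mult norm_power l_def)
    also have "\<dots> \<le> cmod (\<alpha> * w + poly q z)" unfolding eq by (rule norm_diff_ineq)
    finally show "exp (- B) * cmod z ^ degree q \<le> cmod (\<alpha> * w + poly q z)" .
  qed (rule expB)
qed

text \<open>
Enlarging B weakens the estimate, so one constant serves finitely many polynomials and may be taken as large as desired.
\<close>

lemma uniform_polynomial_escape_bound:
  fixes p :: "nat \<Rightarrow> complex poly"
  assumes "finite I" "\<forall>i\<in>I. degree (p i) \<ge> 2"
  obtains B where "B \<ge> B0" "B \<ge> 0"
    "\<And>i z w. i \<in> I \<Longrightarrow> exp B \<le> cmod z \<Longrightarrow> cmod w \<le> cmod z \<Longrightarrow>
       exp (- B) * cmod z ^ degree (p i) \<le> cmod (\<alpha> i * w + poly (p i) z)"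
proof -
  have "\<forall>i. \<exists>b\<ge>0. i \<in> I \<longrightarrow> (\<forall>z w. exp b \<le> cmod z \<longrightarrow> cmod w \<le> cmod z \<longrightarrow>
      exp (- b) * cmod z ^ degree (p i) \<le> cmod (\<alpha> i * w + poly (p i) z))"
    using poly_dominates_linear_term assms(2) by (metis order_refl)
  then obtain b where b: "\<And>i. b i \<ge> 0" "\<And>i z w. i \<in> I \<Longrightarrow> exp (b i) \<le> cmod z \<Longrightarrow> cmod w \<le> cmod z \<Longrightarrow>
      exp (- b i) * cmod z ^ degree (p i) \<le> cmod (\<alpha> i * w + poly (p i) z)" by metis
  define B where "B = \<bar>B0\<bar> + sum b I"
  have le: "b i \<le> B" if "i \<in> I" for i
    using member_le_sum[OF that, of b] b(1) assms(1) unfolding B_def by simp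
  show thesis
  proof (rule that[of B])
    show "B \<ge> B0" "B \<ge> 0" using sum_nonneg[of I b] b(1) unfolding B_def by auto
    fix i z w assume *: "i \<in> I" "exp B \<le> cmod z" "cmod w \<le> cmod z"
    have "exp (- B) * cmod z ^ degree (p i) \<le> exp (- b i) * cmod z ^ degree (p i)"
      using le[OF *(1)] by (intro mult_right_mono) auto
    also have "exp (b i) \<le> cmod z" using le[OF *(1)] *(2) by (meson exp_le_cancel_iff order_trans)
    hence "exp (- b i) * cmod z ^ degree (p i) \<le> cmod (\<alpha> i * w + poly (p i) z)" using * by (intro b)
    finally show "exp (- B) * cmod z ^ degree (p i) \<le> cmod (\<alpha> i * w + poly (p i) z)" .
  qed
qed

text \<open>
The coordinates of the starting point, followed by the last coordinates of its successive images. As each step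
shifts the coordinates, the n-th image occupies the positions n, ..., n + k - 1 of this sequence.
\<close>

definition orbit_sequence ::
    "(nat \<Rightarrow> 'k::finite) \<Rightarrow> (nat \<Rightarrow> complex) \<Rightarrow> (nat \<Rightarrow> complex poly) \<Rightarrow> complex ^ 'k \<Rightarrow> nat \<Rightarrow> complex" where
  "orbit_sequence e \<alpha> p w n =
     (if n < CARD('k) then w $ e (Suc n) else henon_comp e \<alpha> p (Suc n - CARD('k)) w $ e CARD('k))"

lemma henon_comp_nth:
  fixes e :: "nat \<Rightarrow> 'k::finite"
  assumes bij: "bij_betw e {1..CARD('k)} UNIV" and "i < CARD('k)"
  shows "henon_comp e \<alpha> p n w $ e (Suc i) = orbit_sequence e \<alpha> p w (n + i)"
  using assms(2)
proof (induction n arbitrary: i)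
  case 0
  then show ?case by (simp add: orbit_sequence_def)
next
  case (Suc n)
  show ?case
  proof (cases "Suc i < CARD('k)")
    case True
    then show ?thesis using Suc by (simp add: henon_step_nth[OF bij])
  next
    case False
    hence "CARD('k) = Suc i" using Suc.prems by simp
    thus ?thesis unfolding orbit_sequence_def by simp
  qed
qed

lemma orbit_sequence_recurrence:
  fixes e :: "nat \<Rightarrow> 'k::finite"
  assumes bij: "bij_betw e {1..CARD('k)} UNIV"
  shows "orbit_sequence e \<alpha> p w (n + CARD('k)) =
     \<alpha> (Suc n) * orbit_sequence e \<alpha> p w n + poly (p (Suc n)) (orbit_sequence e \<alpha> p w (n + CARD('k) - 1))"
proof -
  have k: "CARD('k) = Suc (CARD('k) - 1)" by simp
  have "orbit_sequence e \<alpha> p w (n + CARD('k)) = henon_comp e \<alpha> p (Suc n) w $ e (Suc (CARD('k) - 1))"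
    using k by (simp add: orbit_sequence_def)
  also have "\<dots> = \<alpha> (Suc n) * henon_comp e \<alpha> p n w $ e (Suc 0) +
       poly (p (Suc n)) (henon_comp e \<alpha> p n w $ e (Suc (CARD('k) - 1)))"
    using henon_step_nth[OF bij, of "CARD('k) - 1" "\<alpha> (Suc n)" "p (Suc n)" "henon_comp e \<alpha> p n w"] by simp
  also have "\<dots> = \<alpha> (Suc n) * orbit_sequence e \<alpha> p w n +
      poly (p (Suc n)) (orbit_sequence e \<alpha> p w (n + (CARD('k) - 1)))"
    by (subst (1 2) henon_comp_nth[OF bij]) auto
  also have "n + (CARD('k) - 1) = n + CARD('k) - 1" using k by simp
  finally show ?thesis .
qed

text \<open>
With cyclically repeated coefficients, iterating F becomes composing more factors; so the states between two iterates
of F belong to one orbit sequence.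
\<close>

lemma henon_comp_periodic:
  assumes "m \<ge> 1"
  shows "henon_comp e (\<lambda>j. \<alpha> ((j - 1) mod m + 1)) (\<lambda>j. p ((j - 1) mod m + 1)) (m * q) =
      henon_comp e \<alpha> p m ^^ q"
proof (induction q)
  case (Suc q)
  let ?\<alpha> = "\<lambda>j. \<alpha> ((j - 1) mod m + 1)" and ?p = "\<lambda>j. p ((j - 1) mod m + 1)"
  have "henon_comp e ?\<alpha> ?p (m * q + n) = henon_comp e \<alpha> p n \<circ> henon_comp e ?\<alpha> ?p (m * q)" if "n \<le> m" for n
    using that by (induction n) (auto simp: o_assoc)
  from this[of m] show ?case using Suc.IH by (simp add: add.commute)
qed simp

lemma prod_periodic:
  fixes f :: "nat \<Rightarrow> nat"
  assumes "\<And>n. f (n + m) = f n" "\<And>n. f n > 0"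
  shows "prod f {n..<n+m} = prod f {..<m}"
proof (induction n)
  case 0
  then show ?case by (simp add: lessThan_atLeast0)
next
  case (Suc n)
  have "f n * prod f {Suc n..<Suc n + m} = prod f {n..<Suc (n + m)}"
    by (subst (2) prod.atLeast_Suc_lessThan) auto
  also have "\<dots> = prod f {n..<n + m} * f n" using assms(1) by simp
  finally show ?case using Suc.IH assms(2)[of n] by simp
qed

text \<open>
All terms before the first one of modulus at least exp (B + 1) are smaller, so the growth hypothesis applies to it.
In terms of Y = exp (-B) |Z| the hypothesis reads Y(new) \<ge> Y(old)^\<delta>, because exp (-B)^2 \<ge> exp (-B)^\<delta>
for \<delta> \<ge> 2. Since Y \<ge> e, the new term is again the largest so far, and the argument repeats.
\<close>

lemma first_large_term_escapes:
  fixes Z :: "nat \<Rightarrow> complex" and \<delta> :: "nat \<Rightarrow> nat"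
  assumes k: "k \<ge> 1" and B: "B \<ge> 0" and \<delta>: "\<And>n. \<delta> n \<ge> 2"
    and growth: "\<And>n. exp B \<le> cmod (Z (n + k - 1)) \<Longrightarrow> cmod (Z n) \<le> cmod (Z (n + k - 1)) \<Longrightarrow>
        exp (- B) * cmod (Z (n + k - 1)) ^ \<delta> n \<le> cmod (Z (n + k))"
    and start: "\<And>i. i < k \<Longrightarrow> cmod (Z i) < exp (B + 1)" and large: "exp (B + 1) \<le> cmod (Z j)"
  obtains N where "exp 1 \<le> exp (- B) * cmod (Z (N + k - 1))"
    "\<And>n. n \<ge> N \<Longrightarrow> (exp (- B) * cmod (Z (n + k - 1))) ^ \<delta> n \<le> exp (- B) * cmod (Z (n + k))"
proof -
  define M where "M = (LEAST j. exp (B + 1) \<le> cmod (Z j))"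
  have M: "exp (B + 1) \<le> cmod (Z M)" unfolding M_def using large by (rule LeastI)
  have small: "cmod (Z i) < exp (B + 1)" if "i < M" for i
    using not_less_Least[of i "\<lambda>j. exp (B + 1) \<le> cmod (Z j)"] that unfolding M_def by simp
  have "k \<le> M" using start[of M] M by (meson not_le)
  define N where "N = M + 1 - k"
  have NM: "N + k - 1 = M" using \<open>k \<le> M\<close> k by (simp add: N_def)
  have Y_ge: "exp 1 \<le> exp (- B) * x" if "exp (B + 1) \<le> x" for x :: real
  proof -
    have "exp 1 = exp (- B) * exp (B + 1)" by (simp add: exp_add[symmetric])
    also have "\<dots> \<le> exp (- B) * x" using that by (intro mult_left_mono) auto
    finally show ?thesis .
  qed
  have grow: "(exp (- B) * cmod (Z (n + k - 1))) ^ \<delta> n \<le> exp (- B) * cmod (Z (n + k))"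
    if "exp (B + 1) \<le> cmod (Z (n + k - 1))" "\<And>i. i \<le> n + k - 1 \<Longrightarrow> cmod (Z i) \<le> cmod (Z (n + k - 1))" for n
  proof -
    let ?x = "cmod (Z (n + k - 1))"
    have "exp B \<le> ?x" using that(1) by (meson exp_le_cancel_iff less_add_one less_imp_le order_trans)
    hence g: "exp (- B) * ?x ^ \<delta> n \<le> cmod (Z (n + k))" using that(2)[of n] k by (intro growth) auto
    have "(exp (- B) * ?x) ^ \<delta> n = exp (- B) ^ \<delta> n * ?x ^ \<delta> n" by (simp add: power_mult_distrib)
    also have "\<dots> \<le> exp (- B) ^ 2 * ?x ^ \<delta> n"
      using B \<delta> by (intro mult_right_mono power_decreasing) auto
    also have "\<dots> = exp (- B) * (exp (- B) * ?x ^ \<delta> n)" by (simp add: power2_eq_square)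
    also have "\<dots> \<le> exp (- B) * cmod (Z (n + k))" using g by (intro mult_left_mono) auto
    finally show ?thesis .
  qed
  have inv: "exp (B + 1) \<le> cmod (Z (n + k - 1)) \<and> (\<forall>i\<le>n + k - 1. cmod (Z i) \<le> cmod (Z (n + k - 1)))"
    if "n \<ge> N" for n
    using that
  proof (induction n rule: dec_induct)
    case base
    show ?case unfolding NM using M small by (metis le_less less_imp_le order_trans)
  next
    case (step n)
    let ?x = "cmod (Z (n + k - 1))"
    have Y: "exp 1 \<le> exp (- B) * ?x" using step.IH by (intro Y_ge) auto
    have "(1::real) \<le> exp 1" by simp
    hence "exp (- B) * ?x \<le> (exp (- B) * ?x) ^ \<delta> n"
      using Y \<delta>[of n] by (intro self_le_power) linarith+
    also have "\<dots> \<le> exp (- B) * cmod (Z (n + k))" using step.IH by (intro grow) auto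
    finally have le: "?x \<le> cmod (Z (n + k))" by simp
    have idx: "Suc n + k - 1 = n + k" by simp
    have "i \<le> n + k - 1 \<or> i = n + k" if "i \<le> n + k" for i using that by auto
    thus ?case unfolding idx using le step.IH by (metis order_refl order_trans)
  qed
  show thesis
  proof (rule that[of N])
    show "exp 1 \<le> exp (- B) * cmod (Z (N + k - 1))" using inv[of N] by (intro Y_ge) auto
  qed (use inv grow in auto)
qed

text \<open>
Over a full period the exponents multiply to d, so Y is raised at least to the power d.
\<close>

lemma doubly_exponential_growth:
  fixes Y :: "nat \<Rightarrow> real" and \<delta> :: "nat \<Rightarrow> nat"
  assumes base: "exp 1 \<le> Y N" and step: "\<And>n. n \<ge> N \<Longrightarrow> Y n ^ \<delta> n \<le> Y (Suc n)"
    and \<delta>: "\<And>n. \<delta> n \<ge> 1" and period: "\<And>n. prod \<delta> {n..<n + m} = d"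
    and j: "N + m * q \<le> j"
  shows "exp (real d ^ q) \<le> Y j"
proof -
  have exp1: "(1::real) \<le> exp 1" by simp
  have Y1: "1 \<le> Y n" if "n \<ge> N" for n
    using that
  proof (induction n rule: dec_induct)
    case base
    show ?case using assms(1) exp1 by linarith
  next
    case (step n)
    have "1 \<le> Y n ^ \<delta> n" using step.IH by (rule one_le_power)
    also have "\<dots> \<le> Y (Suc n)" using assms(2) step by simp
    finally show ?case .
  qed
  have run: "Y n ^ prod \<delta> {n..<n + l} \<le> Y (n + l)" if "n \<ge> N" for n l
  proof (induction l)
    case (Suc l)
    have "Y n ^ prod \<delta> {n..<n + Suc l} = (Y n ^ prod \<delta> {n..<n + l}) ^ \<delta> (n + l)"
      by (simp add: power_mult)
    also have "\<dots> \<le> Y (n + l) ^ \<delta> (n + l)" using Suc.IH Y1[OF that] by (intro power_mono) auto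
    also have "\<dots> \<le> Y (n + Suc l)" using step[of "n + l"] that by simp
    finally show ?case .
  qed simp
  have per: "exp (real d ^ q) \<le> Y (N + m * q)" for q
  proof (induction q)
    case 0
    then show ?case using base by simp
  next
    case (Suc q)
    have "exp (real d ^ Suc q) = exp (real d ^ q) ^ d" by (simp add: exp_of_nat_mult[symmetric])
    also have "\<dots> \<le> Y (N + m * q) ^ d" by (intro power_mono Suc.IH) auto
    also have "\<dots> \<le> Y (N + m * Suc q)" using run[OF le_add1, of "m * q" m] unfolding period by (simp add: add_ac)
    finally show ?case .
  qed
  have "Y (N + m * q) \<le> Y (N + m * q + l)" for l
  proof -
    have "Y (N + m * q) ^ 1 \<le> Y (N + m * q) ^ prod \<delta> {N + m * q..<N + m * q + l}"
      using Y1[of "N + m * q"] \<delta> by (intro power_increasing) (auto simp: Suc_le_eq intro!: prod_pos)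
    also have "\<dots> \<le> Y (N + m * q + l)" by (rule run) simp
    finally show ?thesis by simp
  qed
  from order_trans[OF per this[of "j - (N + m * q)"]] show ?thesis using j by simp
qed

text \<open>
Every coordinate of an iterate is a term of the orbit sequence, fewer than k places before its last coordinate. So
the growth of the sequence after its first large term gives the same rate for all coordinates.
\<close>

theorem henon_orbit_growth:
  fixes e :: "nat \<Rightarrow> 'k::finite" and p :: "nat \<Rightarrow> complex poly" and F :: "complex ^ 'k \<Rightarrow> complex ^ 'k"
  assumes bij: "bij_betw e {1..CARD('k)} UNIV" and m: "m \<ge> 1"
    and deg: "\<forall>i\<in>{1..m}. degree (p i) \<ge> 2" and F: "F = henon_comp e \<alpha> p m"
    and d: "d = (\<Prod>i=1..m. degree (p i))"
  shows "\<exists>R>R0. \<forall>w n j. (\<forall>i. cmod (w $ i) < R) \<longrightarrow> R \<le> cmod ((F ^^ n) w $ j) \<longrightarrow>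
       (\<exists>c>0. \<forall>i. eventually (\<lambda>q. exp (c * real d ^ q) \<le> cmod ((F ^^ q) w $ i)) sequentially)"
proof -
  obtain B where B: "B \<ge> R0" "B \<ge> 0" and dom: "\<And>i z w. i \<in> {1..m} \<Longrightarrow> exp B \<le> cmod z \<Longrightarrow> cmod w \<le> cmod z \<Longrightarrow>
       exp (- B) * cmod z ^ degree (p i) \<le> cmod (\<alpha> i * w + poly (p i) z)"
    using uniform_polynomial_escape_bound[of "{1..m}" p R0 \<alpha>] deg by blast
  let ?a = "\<lambda>j. \<alpha> ((j - 1) mod m + 1)" and ?p = "\<lambda>j. p ((j - 1) mod m + 1)"
  define \<delta> where "\<delta> n = degree (p (n mod m + 1))" for n
  have idx: "n mod m + 1 \<in> {1..m}" for n
    using mod_less_divisor[of m n] m by (auto simp: Suc_le_eq)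
  have \<delta>2: "\<delta> n \<ge> 2" for n unfolding \<delta>_def using deg idx by blast
  have d_prod: "prod \<delta> {n..<n + m} = d" for n
  proof -
    have "prod \<delta> {n..<n + m} = prod \<delta> {..<m}"
    proof (rule prod_periodic)
      show "\<delta> n > 0" for n using \<delta>2[of n] by simp
    qed (simp add: \<delta>_def)
    also have "\<dots> = (\<Prod>i<m. degree (p (Suc i)))" unfolding \<delta>_def by (intro prod.cong) auto
    also have "\<dots> = d" unfolding d by (simp add: prod.atLeast1_atMost_eq)
    finally show ?thesis .
  qed
  have d1: "real d \<ge> 1"
  proof -
    have "d > 0" unfolding d using deg by (intro prod_pos) fastforce
    thus ?thesis by simp
  qed
  show ?thesis
  proof (rule exI[of _ "exp (B + 1)"], intro conjI allI impI)
    show "exp (B + 1) > R0" using exp_ge_add_one_self[of "B + 1"] B by linarith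
    fix w :: "complex ^ 'k" and n j assume start: "\<forall>i. cmod (w $ i) < exp (B + 1)" and large: "exp (B + 1) \<le> cmod ((F ^^ n) w $ j)"
    define Z where "Z = orbit_sequence e ?a ?p w"
    have orbit: "(F ^^ q) w $ e (Suc i) = Z (m * q + i)" if "i < CARD('k)" for q i
      unfolding F Z_def henon_comp_periodic[OF m, symmetric] by (rule henon_comp_nth[OF bij that])
    have rec: "Z (n + CARD('k)) = \<alpha> (n mod m + 1) * Z n + poly (p (n mod m + 1)) (Z (n + CARD('k) - 1))" for n
      using orbit_sequence_recurrence[OF bij, of ?a ?p w n] unfolding Z_def by simp
    obtain i where i: "i < CARD('k)" "j = e (Suc i)" using coordinate_cases[OF bij] .
    obtain N where N: "exp 1 \<le> exp (- B) * cmod (Z (N + CARD('k) - 1))"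
      "\<And>n. n \<ge> N \<Longrightarrow> (exp (- B) * cmod (Z (n + CARD('k) - 1))) ^ \<delta> n \<le> exp (- B) * cmod (Z (n + CARD('k)))"
    proof (rule first_large_term_escapes[of "CARD('k)" B \<delta> Z "m * n + i"])
      fix n assume "exp B \<le> cmod (Z (n + CARD('k) - 1))" "cmod (Z n) \<le> cmod (Z (n + CARD('k) - 1))"
      thus "exp (- B) * cmod (Z (n + CARD('k) - 1)) ^ \<delta> n \<le> cmod (Z (n + CARD('k)))"
        unfolding rec \<delta>_def by (intro dom idx)
    next
      fix i assume "i < CARD('k)"
      thus "cmod (Z i) < exp (B + 1)" using spec[OF start, of "e (Suc i)"] orbit[of i 0] by simp
    qed (use B \<delta>2 large i orbit in \<open>auto simp: Suc_le_eq\<close>)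
    define Y where "Y n = exp (- B) * cmod (Z (n + CARD('k) - 1))" for n
    \<comment> \<open>After N + k turns the window lies beyond position N of the shifted sequence Y. From then on each further
      turn contributes one factor d in the exponent; c accounts for the turns lost at the beginning.\<close>
    define c where "c = inverse (real d ^ (N + CARD('k)))"
    have "c > 0" using d1 by (simp add: c_def)
    moreover have "eventually (\<lambda>q. exp (c * real d ^ q) \<le> cmod ((F ^^ q) w $ i)) sequentially" for i
    proof (rule eventually_sequentiallyI[of "N + CARD('k)"])
      fix q assume q: "N + CARD('k) \<le> q"
      obtain i' where i': "i' < CARD('k)" "i = e (Suc i')" using coordinate_cases[OF bij] .
      define l where "l = q - (N + CARD('k))"
      have ql: "q = N + CARD('k) + l" using q by (simp add: l_def)
      have mq: "N + CARD('k) + m * l \<le> m * q"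
        unfolding ql using m mult_le_mono1[of 1 m "N + CARD('k)"] by (simp add: algebra_simps)
      define n where "n = m * q + i' + 1 - CARD('k)"
      have n: "n + CARD('k) - 1 = m * q + i'" "N + m * l \<le> n" using mq unfolding n_def by auto
      have "c * real d ^ q = real d ^ l"
        unfolding c_def ql power_add using d1 by (simp add: field_simps)
      hence "exp (c * real d ^ q) = exp (real d ^ l)" by simp
      also have "\<dots> \<le> Y n"
        by (rule doubly_exponential_growth[of Y N \<delta> m])
          (use N d_prod n(2) \<delta>2 in \<open>auto simp: Y_def intro: order_trans[OF _ \<delta>2]\<close>)
      also have "\<dots> \<le> 1 * cmod (Z (m * q + i'))" unfolding Y_def n(1) using B by (intro mult_right_mono) auto
      also have "\<dots> = cmod ((F ^^ q) w $ i)" using orbit[OF i'(1)] i'(2) by simp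
      finally show "exp (c * real d ^ q) \<le> cmod ((F ^^ q) w $ i)" .
    qed
    ultimately show "\<exists>c>0. \<forall>i. eventually (\<lambda>q. exp (c * real d ^ q) \<le> cmod ((F ^^ q) w $ i)) sequentially"
      by blast
  qed
qed

section \<open>Order and type of the coordinates of the unstable manifold\<close>

theorem theorem1p4:
  fixes e :: "nat \<Rightarrow> 'k::finite"
    and m :: nat
    and \<alpha> :: "nat \<Rightarrow> complex"
    and p :: "nat \<Rightarrow> complex poly"
    and d :: nat
    and F :: "complex ^ 'k \<Rightarrow> complex ^ 'k"
    and a :: "complex ^ 'k"
    and lam :: complex
    and H :: "complex \<Rightarrow> complex ^ 'k"
  assumes "CARD('k) \<ge> 2"
    and "bij_betw e {1..CARD('k)} UNIV"
    and "m \<ge> 2"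
    and "\<forall>i\<in>{1..m}. degree (p i) \<ge> 2 \<and> \<alpha> i \<noteq> 0"
    and "F = henon_comp e \<alpha> p m"
    and "d = (\<Prod>i=1..m. degree (p i))"
    and "saddle_point F a lam"
    and "\<forall>i\<in>{1..CARD('k)}. (\<lambda>t. H t $ e i) holomorphic_on UNIV"
    and "range H = unstable_manifold F a"
    and "H 0 = a"
    and "\<forall>t. F (H t) = H (lam * t)"
  shows "\<forall>i\<in>{1..CARD('k)}.
           transcendental_entire (\<lambda>t. H t $ e i) \<and>
           entire_order (\<lambda>t. H t $ e i) = ereal (ln (real d) / ln (cmod lam)) \<and>
           mean_type (\<lambda>t. H t $ e i)"
proof -
  note bij = assms(2)
  have H: "entire_curve H" unfolding entire_curve_def
  proof
    fix j
    obtain i where "i < CARD('k)" "j = e (Suc i)" using coordinate_cases[OF bij] .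
    thus "(\<lambda>t. H t $ j) holomorphic_on UNIV" using assms(8) by auto
  qed
  obtain A ev where A: "(F has_derivative (\<lambda>v. A *v v)) (at a)" "F a = a"
      "\<And>x. det (mat x - A) = (\<Prod>i=1..CARD('k). x - ev i)"
      "\<And>i. i \<in> {1..<CARD('k)} \<Longrightarrow> cmod (ev i) < 1" "cmod lam > 1" "lam = ev CARD('k)"
    using assms(7) unfolding saddle_point_def eigenvalue_list_def by auto
  have lam0: "lam \<noteq> 0" using A(5) by auto
  obtain F' where F': "has_strict_derivative F F' a"
    using has_strict_derivative_henon_comp[OF bij] assms(5) by metis
  \<comment> \<open>The derivative found for the composition is the one in the saddle hypothesis, by uniqueness of derivatives.\<close>
  have strict: "has_strict_derivative F (\<lambda>v. A *v v) a"
    using F' has_derivative_unique[OF has_strict_derivative_imp_has_derivative[OF F'] A(1)] by simp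
  have d2: "d \<ge> 2"
  proof -
    have "degree (p 1) dvd d" unfolding assms(6) using assms(3) by (intro dvd_prodI) auto
    moreover have "d > 0" unfolding assms(6) using assms(4) by (intro prod_pos) fastforce
    ultimately have "degree (p 1) \<le> d" by (rule dvd_imp_le)
    moreover have "2 \<le> degree (p 1)" using assms(3,4) by auto
    ultimately show ?thesis by linarith
  qed
  define \<rho> where "\<rho> = ln (real d) / ln (cmod lam)"
  have \<rho>: "\<rho> > 0" unfolding \<rho>_def using d2 A(5) by (intro divide_pos_pos ln_gt_zero) auto
  have Fpow: "(F ^^ n) (H s) = H (lam ^ n * s)" for n s
    using assms(11) by (induction n) (auto simp: mult.assoc)
  obtain C where C: "C \<ge> 1" "\<And>z. 1 + norm (F z) \<le> C * (1 + norm z) ^ d"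
    using henon_comp_growth[OF bij, of m p \<alpha>] assms(4,5,6) by fastforce
  obtain K where K: "\<And>t. cmod t \<ge> 1 \<Longrightarrow> norm (H t) \<le> exp (K * cmod t powr \<rho>)"
    using curve_growth_from_functional_equation[OF H _ A(5) d2 C] assms(11) unfolding \<rho>_def by metis
  have "m \<ge> 1" "\<forall>i\<in>{1..m}. degree (p i) \<ge> 2" using assms(3,4) by auto
  from henon_orbit_growth[OF bij this assms(5,6), of "norm a"]
  obtain R where R: "R > norm a"
    "\<And>w n j. (\<forall>i. cmod (w $ i) < R) \<Longrightarrow> R \<le> cmod ((F ^^ n) w $ j) \<Longrightarrow>
       \<exists>c>0. \<forall>i. eventually (\<lambda>q. exp (c * real d ^ q) \<le> cmod ((F ^^ q) w $ i)) sequentially"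
    by blast
  have "\<exists>z\<in>unstable_manifold F a. z \<noteq> a"
  proof (rule unstable_manifold_nontrivial[OF strict A(2) _ _ A(5)])
    show "inj F" using inj_henon_comp[OF bij assms(1)] assms(4,5) by blast
    show "entire_curve (\<lambda>t. F (G t))" if "entire_curve G" for G
      unfolding assms(5) by (rule entire_curve_henon_comp[OF bij that])
    show "det (mat lam - A) = 0" unfolding A(3) A(6) by (rule prod_zero) auto
    fix n :: nat assume n: "n \<ge> 2"
    have big: "cmod lam < cmod (lam ^ n)"
      using power_strict_increasing[of 1 n "cmod lam"] n A(5) by (simp add: norm_power)
    have "lam ^ n \<noteq> ev i" if "i \<in> {1..CARD('k)}" for i
    proof (cases "i = CARD('k)")
      case True
      thus ?thesis using big A(6) by auto
    next
      case False
      hence "cmod (ev i) < 1" using that by (intro A(4)) auto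
      thus ?thesis using big A(5) by auto
    qed
    thus "det (mat (lam ^ n) - A) \<noteq> 0" unfolding A(3) by (simp add: prod_zero_iff)
  qed
  then obtain t1 where t1: "H t1 \<noteq> H 0" using assms(9,10) by (metis imageE)
  then obtain j where j: "H t1 $ j \<noteq> H 0 $ j" by (auto simp: vec_eq_iff)
  have "\<exists>t. R \<le> cmod (H t $ j)"
  proof (rule ccontr)
    assume "\<not> ?thesis"
    hence "bounded (range (\<lambda>t. H t $ j))" unfolding bounded_iff by (auto intro!: exI[of _ R] simp: not_le less_imp_le)
    then obtain c where "\<And>t. H t $ j = c"
      using Liouville_theorem[of "\<lambda>t. H t $ j"] H unfolding entire_curve_def constant_on_def by blast
    thus False using j by simp
  qed
  then obtain t where t: "R \<le> cmod (H t $ j)" by blast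
  have t0: "t \<noteq> 0"
  proof
    assume "t = 0"
    hence "R \<le> cmod (a $ j)" using t assms(10) by simp
    thus False using Finite_Cartesian_Product.norm_nth_le[of a j] R(1) by linarith
  qed
  have "(\<lambda>n. t * inverse lam ^ n) \<longlonglongrightarrow> t * 0"
    using A(5) by (intro tendsto_intros LIMSEQ_power_zero) (simp add: norm_inverse inverse_less_1_iff)
  hence "filterlim (\<lambda>n. t * inverse lam ^ n) (at 0) sequentially"
    using t0 lam0 by (simp add: filterlim_at)
  hence "(\<lambda>n. H (t * inverse lam ^ n)) \<longlonglongrightarrow> a"
    using filterlim_compose[OF entire_curve_tendsto[OF H, of 0]] assms(10) by auto
  hence "(\<lambda>n. norm (H (t * inverse lam ^ n))) \<longlonglongrightarrow> norm a" by (rule tendsto_norm)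
  hence "eventually (\<lambda>n. norm (H (t * inverse lam ^ n)) < R) sequentially" using R(1) by (rule order_tendstoD)
  then obtain n where n: "norm (H (t * inverse lam ^ n)) < R"
    using eventually_happens'[OF sequentially_bot] by blast
  \<comment> \<open>Going back along the curve from the large point H(t) to a point near a makes the initial window small.\<close>
  define s where "s = t * inverse lam ^ n"
  have s0: "s \<noteq> 0" using t0 lam0 by (simp add: s_def)
  have "(F ^^ n) (H s) = H t" unfolding Fpow s_def using lam0 by (simp add: power_inverse field_simps)
  then obtain c where c: "c > 0" "\<And>i. eventually (\<lambda>q. exp (c * real d ^ q) \<le> cmod ((F ^^ q) (H s) $ i)) sequentially"
  proof -
    have "cmod (H s $ i) < R" for i
      using Finite_Cartesian_Product.norm_nth_le[of "H s" i] n unfolding s_def by (rule le_less_trans)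
    moreover have "R \<le> cmod ((F ^^ n) (H s) $ j)" using t \<open>(F ^^ n) (H s) = H t\<close> by simp
    ultimately show ?thesis using R(2) that by blast
  qed
  define c' where "c' = c / cmod s powr \<rho>"
  have c': "c' > 0" using c s0 by (simp add: c'_def)
  have sq: "c' * cmod (lam ^ q * s) powr \<rho> = c * real d ^ q" for q
  proof -
    have "cmod (lam ^ q * s) powr \<rho> = (cmod lam ^ q) powr \<rho> * cmod s powr \<rho>"
      by (simp add: norm_mult norm_power powr_mult)
    also have "(cmod lam ^ q) powr \<rho> = real d ^ q"
      unfolding \<rho>_def using A(5) d2 by (intro power_powr_log_ratio) auto
    finally show ?thesis using s0 by (simp add: c'_def)
  qed
  have top: "filterlim (\<lambda>q. cmod (lam ^ q * s)) at_top sequentially"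
  proof -
    have "filterlim (\<lambda>q. cmod (lam ^ q)) at_top sequentially"
      by (intro filterlim_at_infinity_imp_norm_at_top filterlim_realpow_sequentially_gt1 A(5))
    hence "filterlim (\<lambda>q. cmod s * cmod (lam ^ q)) at_top sequentially"
      using s0 by (intro filterlim_tendsto_pos_mult_at_top[OF tendsto_const]) auto
    thus ?thesis by (simp add: norm_mult norm_power mult.commute)
  qed
  show ?thesis
  proof
    fix i
    let ?h = "\<lambda>t. H t $ e i"
    have hol: "?h holomorphic_on UNIV" using H by (simp add: entire_curve_def)
    have up: "cmod (?h z) \<le> exp (K * cmod z powr \<rho>)" if "cmod z \<ge> 1" for z
      using K[OF that] Finite_Cartesian_Product.norm_nth_le order_trans by blast
    have low: "eventually (\<lambda>q. exp (c' * cmod (lam ^ q * s) powr \<rho>) \<le> cmod (?h (lam ^ q * s))) sequentially"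
      using c(2)[of "e i"] unfolding sq Fpow .
    note order_and_type_from_bounds[OF hol \<rho> c' up top low]
    thus "transcendental_entire ?h \<and> entire_order ?h = ereal (ln (real d) / ln (cmod lam)) \<and> mean_type ?h"
      by (simp add: \<rho>_def)
  qed
qed

end
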